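(* Let $d\ge 2$, let $R\subset X^d$ be a region not containing $\mathbf 0$, let $b\in\Omega$ be a height function, and let $w:E^d(R)\to(0,\infty)$ be a weight function. Let $\mathbb P_w$ be the Boltzmann measure on $\Omega(R,b)$ with weight $w$. Let $(f_1,f_2)$ be a pair of random height functions with law $\mathbb P_w\times\mathbb P_w$ (also denoted $\mathbb P_w$, with expectation $\mathbb E_w$), let $g:=f_1-f_2$, and write $f$ for $f_1$. Then for any $\mathbf x,\mathbf y\in X^d$, \[\operatorname{Cov}_w(f(\mathbf x),f(\mathbf y))=\tfrac12(d+1)^2\,\mathbb E_w\, d_{\operatorname{LSD}(g)}(\mathbf 0,\mathbf z),\] where $\mathbf z$ is the last $\operatorname{LSD}(g)$-vertex on the $\operatorname{LSD}(g)$-path from $\mathbf 0$ to $\mathbf x$ that also appears on the $\operatorname{LSD}(g)$-path from $\mathbf 0$ to $\mathbf y$. In other words, the covariance of $f(\mathbf x)$ and $f(\mathbf y)$ equals $\frac12(d+1)^2$ times the expectation of the number of $g$-boundaries that separate both $\mathbf x$ and $\mathbf y$ from $\mathbf 0$.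
   Context: Fix an integer $d\ge 2$. Let $\mathbf e_1,\dots,\mathbf e_{d+1}$ be the standard basis of $\mathbb R^{d+1}$, $\mathbf n=\mathbf e_1+\dots+\mathbf e_{d+1}$, $H=\mathbf n^\perp\subset\mathbb R^{d+1}$, $P$ the orthogonal projection onto $H$, and $\mathbf g_i=P\mathbf e_i=\mathbf e_i-\mathbf n/(d+1)$. The simplicial lattice $(X^d,E^d)$ is the graph with vertex set $X^d=P(\mathbb Z^{d+1})\subset H$ (equivalently $\mathbb Z^{d+1}/\mathbb Z\mathbf n$) and edges $\{\mathbf x,\mathbf x+\mathbf g_i\}$, $\mathbf x\in X^d$, $1\le i\le d+1$. A height function is a function $f:X^d\to\mathbb Z$ with $f(\mathbf 0)\in(d+1)\mathbb Z$ and $f(\mathbf x+\mathbf g_i)-f(\mathbf x)\in\{1,-d\}$ for all $\mathbf x\in X^d$ and $i$. $\Omega$ is the set of height functions. For $f\in\Omega$, $T(f):=\{\{\mathbf x,\mathbf x+\mathbf g_i\}\in E^d: f(\mathbf x+\mathbf g_i)-f(\mathbf x)=-d\}$. A simplicial loop is a closed path $(\mathbf s_k)_{0\le k\le d+1}$ in $X^d$ with $\mathbf s_k=\mathbf s_{k-1}+\mathbf g_{\xi(k)}$ for some permutation $\xi$ of $\{1,\dots,d+1\}$. A region is a finite set $R\subset X^d$ whose complement $R^{\mathsf c}=X^d\smallsetminus R$ is connected in $(X^d,E^d)$. $E^d(R)$ is the set of edges incident to at least one vertex of $R$. $\Omega(R,b):=\{f\in\Omega: f|_{R^{\mathsf c}}=b|_{R^{\mathsf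 c}}\}$, a finite set. The Boltzmann measure with weight $w$ is the probability measure $\mathbb P_w$ on $\Omega(R,b)$ with $\mathbb P_w(f)\propto\prod_{e\in T(f)\cap E^d(R)}w(e)$. For $f_1,f_2\in\Omega$ and $g=f_1-f_2$ put $V_g:=\{e\in E^d: g\text{ is not constant on }e\}$ (the symmetric difference of $T(f_1)$ and $T(f_2)$). The boundary graph $G_g$ has vertex set $V_g$, and two elements of $V_g$ are adjacent if some simplicial loop traverses both. A $g$-boundary is a connected component of $G_g$, considered as a subset of $E^d$. A $g$-level set is a connected component of the graph $(X^d,E^d\smallsetminus V_g)$, considered as a subset of $X^d$. For $e\in V_g$, $\mathbf x_g^-(e)$ and $\mathbf x_g^+(e)$ are the endpoints of $e$ at which $g$ takes the smaller, respectively larger, value; $\mathbf x_g^\pm(E)=\{\mathbf x_g^\pm(e):e\in E\}$. $\operatorname{LSD}(g)$ is the graph whose vertices are the $g$-level sets and whose edges are the $g$-boundaries, where a $g$-boundary $E$ connects the $g$-level set containing $\mathbf x_g^-(E)$ to the one containing $\mathbf x_g^+(E)$ (it is known that this is well-defined and a tree). A vertex of $X^d$ is identified with the $g$-level set containing it when speaking of paths and of the graph distance $d_{\operatorname{LSD}(g)}$ in $\operatorname{LSD}(g)$. A $g$-boundary $E$ separates $\mathbf x$ from $\mathbf 0$ if $\mathbf x$ and $\mathbf 0$ lie in different connected components of $(X^d,E^d\smallsetminus E)$. *)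

theory Defs
  imports "HOL-Probability.Probability"
begin

text \<open>
  Coordinates of \<open>\<real>\<^bsup>d+1\<^esup>\<close> are indexed by a finite type \<open>'n\<close> with \<open>CARD('n) = d + 1\<close>. Hence \<open>d + 1\<close>
  appears as \<open>CARD('n)\<close> and \<open>-d\<close> as \<open>1 - int CARD('n)\<close> in the definitions below.
\<close>


subsection \<open>Elementary graph notions\<close>

text \<open>
  A graph is given by its vertex set and a symmetric adjacency relation; adjacency between
  points that are not both vertices is disregarded.
\<close>

definition graph_component :: "'a set \<Rightarrow> ('a \<times> 'a) set \<Rightarrow> 'a \<Rightarrow> 'a set" where
  "graph_component V r x = {y. (x, y) \<in> (r \<inter> V \<times> V)\<^sup>*}"

definition graph_components :: "'a set \<Rightarrow> ('a \<times> 'a) set \<Rightarrow> 'a set set" where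
  "graph_components V r = graph_component V r ` V"

definition graph_connected :: "'a set \<Rightarrow> ('a \<times> 'a) set \<Rightarrow> bool" where
  "graph_connected V r \<longleftrightarrow> (\<forall>x\<in>V. \<forall>y\<in>V. y \<in> graph_component V r x)"

definition graph_path :: "('a \<times> 'a) set \<Rightarrow> 'a \<Rightarrow> 'a \<Rightarrow> 'a list \<Rightarrow> bool" where
  "graph_path r u v p \<longleftrightarrow>
     p \<noteq> [] \<and> hd p = u \<and> last p = v \<and> distinct p \<and> successively (\<lambda>a b. (a, b) \<in> r) p"

text \<open>Meaningful only where there is exactly one path from \<open>u\<close> to \<open>v\<close>, as in a tree.\<close>

definition tree_path :: "('a \<times> 'a) set \<Rightarrow> 'a \<Rightarrow> 'a \<Rightarrow> 'a list" where
  "tree_path r u v = (THE p. graph_path r u v p)"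

definition graph_dist :: "('a \<times> 'a) set \<Rightarrow> 'a \<Rightarrow> 'a \<Rightarrow> nat" where
  "graph_dist r u v = (LEAST n. (u, v) \<in> r ^^ n)"

definition edge_rel :: "'a set set \<Rightarrow> ('a \<times> 'a) set" where
  "edge_rel E = {(x, y). {x, y} \<in> E}"


subsection \<open>The simplicial lattice\<close>

definition all_ones :: "real ^ 'n" where
  "all_ones = (\<Sum>i\<in>UNIV. axis i 1)"

definition hyperplane_H :: "(real ^ 'n) set" where
  "hyperplane_H = {v. v \<bullet> all_ones = 0}"

definition proj_H :: "real ^ 'n \<Rightarrow> real ^ 'n" where
  "proj_H v = v - ((v \<bullet> all_ones) / ((all_ones :: real ^ 'n) \<bullet> all_ones)) *\<^sub>R all_ones"

definition simplicial_lattice :: "(real ^ 'n) set" where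
  "simplicial_lattice = proj_H ` {v. \<forall>i. v $ i \<in> \<int>}"

text \<open>The vectors \<open>g\<^sub>i\<close>.\<close>

definition gen :: "'n::finite \<Rightarrow> real ^ 'n" where
  "gen i = proj_H (axis i 1)"

definition lattice_edges :: "(real ^ 'n) set set" where
  "lattice_edges = {{x, x + gen i} | x i. x \<in> simplicial_lattice}"

definition simplicial_loop :: "(nat \<Rightarrow> real ^ 'n) \<Rightarrow> bool" where
  "simplicial_loop s \<longleftrightarrow>
     s 0 \<in> simplicial_lattice \<and> s CARD('n) = s 0 \<and>
     (\<exists>\<xi>. bij_betw \<xi> {1..CARD('n)} (UNIV :: 'n set) \<and>
          (\<forall>k\<in>{1..CARD('n)}. s k = s (k - 1) + gen (\<xi> k)))"

definition traverses :: "(nat \<Rightarrow> real ^ 'n) \<Rightarrow> (real ^ 'n) set \<Rightarrow> bool" where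
  "traverses s e \<longleftrightarrow> (\<exists>k\<in>{1..CARD('n)}. e = {s (k - 1), s k})"

definition region :: "(real ^ 'n) set \<Rightarrow> bool" where
  "region R \<longleftrightarrow> finite R \<and> R \<subseteq> simplicial_lattice \<and>
     graph_connected (simplicial_lattice - R) (edge_rel lattice_edges)"

definition edges_at :: "(real ^ 'n) set \<Rightarrow> (real ^ 'n) set set" where
  "edges_at R = {e \<in> lattice_edges. e \<inter> R \<noteq> {}}"


subsection \<open>Height functions and the Boltzmann measure\<close>

text \<open>
  Height functions live on the lattice only. They are made extensional (\<open>undefined\<close> off the
  lattice), so that equality of height functions is equality on the lattice.
\<close>

definition height_functions :: "(real ^ 'n \<Rightarrow> int) set" where
  "height_functions = {f \<in> simplicial_lattice \<rightarrow>\<^sub>E UNIV.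
     int CARD('n) dvd f 0 \<and>
     (\<forall>x\<in>simplicial_lattice. \<forall>i. f (x + gen i) - f x \<in> {1, 1 - int CARD('n)})}"

text \<open>The edge set \<open>T(f)\<close>.\<close>

definition down_edges :: "(real ^ 'n \<Rightarrow> int) \<Rightarrow> (real ^ 'n) set set" where
  "down_edges f =
     {{x, x + gen i} | x i. x \<in> simplicial_lattice \<and> f (x + gen i) - f x = 1 - int CARD('n)}"

definition height_functions_on ::
    "(real ^ 'n) set \<Rightarrow> (real ^ 'n \<Rightarrow> int) \<Rightarrow> (real ^ 'n \<Rightarrow> int) set" where
  "height_functions_on R b =
     {f \<in> height_functions. \<forall>x\<in>simplicial_lattice - R. f x = b x}"

definition boltzmann_weight ::
    "(real ^ 'n) set \<Rightarrow> ((real ^ 'n) set \<Rightarrow> real) \<Rightarrow> (real ^ 'n \<Rightarrow> int) \<Rightarrow> real" where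
  "boltzmann_weight R w f = (\<Prod>e\<in>down_edges f \<inter> edges_at R. w e)"

definition boltzmann ::
    "(real ^ 'n) set \<Rightarrow> (real ^ 'n \<Rightarrow> int) \<Rightarrow> ((real ^ 'n) set \<Rightarrow> real) \<Rightarrow> (real ^ 'n \<Rightarrow> int) pmf" where
  "boltzmann R b w = embed_pmf (\<lambda>f.
     if f \<in> height_functions_on R b
     then boltzmann_weight R w f / (\<Sum>h\<in>height_functions_on R b. boltzmann_weight R w h)
     else 0)"

definition covariance :: "'a pmf \<Rightarrow> ('a \<Rightarrow> real) \<Rightarrow> ('a \<Rightarrow> real) \<Rightarrow> real" where
  "covariance p A B = measure_pmf.expectation p
     (\<lambda>\<omega>. (A \<omega> - measure_pmf.expectation p A) * (B \<omega> - measure_pmf.expectation p B))"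


subsection \<open>Boundaries, level sets and the level set decomposition\<close>

text \<open>The edge set \<open>V\<^sub>g\<close>.\<close>

definition nonconst_edges :: "(real ^ 'n \<Rightarrow> int) \<Rightarrow> (real ^ 'n) set set" where
  "nonconst_edges g = {e \<in> lattice_edges. \<exists>u\<in>e. \<exists>v\<in>e. g u \<noteq> g v}"

definition boundaries :: "(real ^ 'n \<Rightarrow> int) \<Rightarrow> (real ^ 'n) set set set" where
  "boundaries g = graph_components (nonconst_edges g)
     {(e, e'). \<exists>s. simplicial_loop s \<and> traverses s e \<and> traverses s e'}"

definition level_set :: "(real ^ 'n \<Rightarrow> int) \<Rightarrow> real ^ 'n \<Rightarrow> (real ^ 'n) set" where
  "level_set g x =
     graph_component simplicial_lattice (edge_rel (lattice_edges - nonconst_edges g)) x"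

definition level_sets :: "(real ^ 'n \<Rightarrow> int) \<Rightarrow> (real ^ 'n) set set" where
  "level_sets g =
     graph_components simplicial_lattice (edge_rel (lattice_edges - nonconst_edges g))"

text \<open>
  On an edge in \<open>nonconst_edges g\<close> the two values of \<open>g\<close> differ, so the minimiser and the maximiser
  are unique.
\<close>

definition lower_end :: "(real ^ 'n \<Rightarrow> int) \<Rightarrow> (real ^ 'n) set \<Rightarrow> real ^ 'n" where
  "lower_end g e = arg_min_on g e"

definition upper_end :: "(real ^ 'n \<Rightarrow> int) \<Rightarrow> (real ^ 'n) set \<Rightarrow> real ^ 'n" where
  "upper_end g e = arg_max_on g e"

definition boundary_connects ::
    "(real ^ 'n \<Rightarrow> int) \<Rightarrow> (real ^ 'n) set set \<Rightarrow> (real ^ 'n) set \<Rightarrow> (real ^ 'n) set \<Rightarrow> bool" where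
  "boundary_connects g E L L' \<longleftrightarrow> lower_end g ` E \<subseteq> L \<and> upper_end g ` E \<subseteq> L'"

text \<open>Adjacency in the undirected graph whose vertices are the level sets and whose edges are
  the boundaries. The two ends of a boundary \<open>E\<close> are the level sets containing \<open>lower_end g ` E\<close> and
  \<open>upper_end g ` E\<close>.\<close>

definition LSD :: "(real ^ 'n \<Rightarrow> int) \<Rightarrow> ((real ^ 'n) set \<times> (real ^ 'n) set) set" where
  "LSD g = {(L, L'). L \<in> level_sets g \<and> L' \<in> level_sets g \<and>
     (\<exists>E\<in>boundaries g. boundary_connects g E L L' \<or> boundary_connects g E L' L)}"

definition last_common_vertex ::
    "(real ^ 'n \<Rightarrow> int) \<Rightarrow> real ^ 'n \<Rightarrow> real ^ 'n \<Rightarrow> (real ^ 'n) set" where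
  "last_common_vertex g x y =
     last (filter (\<lambda>L. L \<in> set (tree_path (LSD g) (level_set g 0) (level_set g y)))
        (tree_path (LSD g) (level_set g 0) (level_set g x)))"

definition separates_from_0 :: "(real ^ 'n) set set \<Rightarrow> real ^ 'n \<Rightarrow> bool" where
  "separates_from_0 E x \<longleftrightarrow>
     graph_component simplicial_lattice (edge_rel (lattice_edges - E)) x \<noteq>
     graph_component simplicial_lattice (edge_rel (lattice_edges - E)) 0"


subsection \<open>Consistency of the definitions\<close>

lemma inner_all_ones: "v \<bullet> all_ones = (\<Sum>i\<in>UNIV. v $ i)"
  by (simp add: all_ones_def inner_sum_right inner_axis)

lemma all_ones_nth: "all_ones $ i = 1"
  by (simp add: all_ones_def axis_def if_distrib cong: if_cong)

lemma all_ones_inner_self: "(all_ones :: real ^ 'n) \<bullet> all_ones = real CARD('n)"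
  by (simp add: inner_all_ones all_ones_nth)

lemma proj_H_in: "proj_H v \<in> hyperplane_H"
  by (simp add: proj_H_def hyperplane_H_def inner_diff_left all_ones_inner_self)

lemma proj_H_orthogonal: "h \<in> hyperplane_H \<Longrightarrow> (v - proj_H v) \<bullet> h = 0"
  by (simp add: proj_H_def hyperplane_H_def inner_commute)

lemma gen_eq: "(gen i :: real ^ 'n) = axis i 1 - (1 / real CARD('n)) *\<^sub>R all_ones"
proof -
  have "axis i 1 \<bullet> (all_ones :: real ^ 'n) = 1"
    by (simp add: inner_axis' all_ones_nth)
  then show ?thesis
    by (simp add: gen_def proj_H_def all_ones_inner_self)
qed

lemma proj_H_add: "proj_H (u + v) = proj_H u + proj_H v"
  by (simp add: proj_H_def inner_add_left add_divide_distrib scaleR_add_left)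

lemma lattice_add_gen:
  assumes "x \<in> simplicial_lattice" shows "x + gen i \<in> simplicial_lattice"
proof -
  obtain v where v: "\<forall>j. v $ j \<in> \<int>" "x = proj_H v"
    using assms by (auto simp: simplicial_lattice_def)
  have "\<forall>j. (v + axis i 1) $ j \<in> \<int>"
    using v(1) by (auto simp: axis_def)
  then show ?thesis
    using v(2) by (auto simp: simplicial_lattice_def gen_def proj_H_add[symmetric])
qed

lemma gen_nonzero:
  assumes "CARD('n) \<ge> 2" shows "gen (i :: 'n) \<noteq> (0 :: real ^ 'n)"
proof
  assume "gen i = (0 :: real ^ 'n)"
  then have "(gen i :: real ^ 'n) $ i = 0"
    by simp
  then show False
    using assms by (simp add: gen_eq all_ones_nth axis_def)
qed

lemma lattice_ray:
  assumes "x \<in> simplicial_lattice" shows "x + real k *\<^sub>R gen i \<in> simplicial_lattice"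
proof (induction k)
  case (Suc k)
  then have "(x + real k *\<^sub>R gen i) + gen i \<in> simplicial_lattice"
    by (rule lattice_add_gen)
  then show ?case
    by (simp add: algebra_simps)
qed (use assms in simp)

lemma height_ray:
  fixes f :: "real ^ 'n \<Rightarrow> int"
  assumes "f \<in> height_functions" "x \<in> simplicial_lattice"
  shows "\<bar>f (x + real k *\<^sub>R gen i) - f x\<bar> \<le> int k * int CARD('n)"
proof (induction k)
  case (Suc k)
  let ?y = "x + real k *\<^sub>R gen i"
  have "f (?y + gen i) - f ?y \<in> {1, 1 - int CARD('n)}"
    using assms lattice_ray[OF assms(2)] by (auto simp: height_functions_def)
  moreover have "CARD('n) \<ge> 1"
    by (simp add: Suc_leI)
  ultimately have "\<bar>f (?y + gen i) - f ?y\<bar> \<le> int CARD('n)"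
    by auto
  moreover have "?y + gen i = x + real (Suc k) *\<^sub>R gen i"
    by (simp add: algebra_simps)
  ultimately show ?case
    using Suc by (simp add: algebra_simps)
qed simp

lemma finite_height_functions_on:
  fixes R :: "(real ^ 'n) set"
  assumes card: "CARD('n) \<ge> 2" and R: "region R"
  shows "finite (height_functions_on R b)"
proof -
  fix i :: 'n
  have "\<exists>k. x + real k *\<^sub>R gen i \<notin> R" for x
  proof (rule ccontr)
    assume "\<nexists>k. x + real k *\<^sub>R gen i \<notin> R"
    then have "range (\<lambda>k. x + real k *\<^sub>R gen i) \<subseteq> R"
      by auto
    moreover have "inj (\<lambda>k. x + real k *\<^sub>R gen i)"
      by (rule injI) (use gen_nonzero[OF card, of i] in auto)
    ultimately show False
      using R finite_subset range_inj_infinite by (auto simp: region_def)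
  qed
  then obtain K where K: "\<And>x. x + real (K x) *\<^sub>R gen i \<notin> R"
    by metis
  let ?c = "\<lambda>x. b (x + real (K x) *\<^sub>R gen i)"
  let ?m = "\<lambda>x. int (K x) * int CARD('n)"
  let ?B = "\<lambda>x. {?c x - ?m x .. ?c x + ?m x}"
  have "f x \<in> ?B x" if "f \<in> height_functions_on R b" "x \<in> R" for f x
  proof -
    have x: "x \<in> simplicial_lattice"
      using that R by (auto simp: region_def)
    have "f (x + real (K x) *\<^sub>R gen i) = ?c x"
      using that(1) lattice_ray[OF x] K by (auto simp: height_functions_on_def)
    then show ?thesis
      using height_ray[of f x "K x" i] that(1) x
      by (auto simp: height_functions_on_def abs_le_iff)
  qed
  then have "(\<lambda>f. restrict f R) ` height_functions_on R b \<subseteq> Pi\<^sub>E R ?B"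
    by fastforce
  moreover have "finite (Pi\<^sub>E R ?B)"
    using R by (intro finite_PiE) (auto simp: region_def)
  moreover have "inj_on (\<lambda>f. restrict f R) (height_functions_on R b)"
  proof (rule inj_onI, rule ext)
    fix f h x
    assume fh: "f \<in> height_functions_on R b" "h \<in> height_functions_on R b"
      and eq: "restrict f R = restrict h R"
    consider "x \<in> R" | "x \<in> simplicial_lattice - R" | "x \<notin> simplicial_lattice"
      by blast
    then show "f x = h x"
    proof cases
      case 1
      then show ?thesis using eq by (metis restrict_apply')
    next
      case 2
      then show ?thesis using fh by (simp add: height_functions_on_def)
    next
      case 3
      then show ?thesis
        using fh by (auto simp: height_functions_on_def height_functions_def PiE_def extensional_def)
    qed
  qed
  ultimately show ?thesis
    using finite_subset finite_imageD by blast
qed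

lemma pmf_boltzmann:
  fixes R :: "(real ^ 'n) set"
  assumes card: "CARD('n) \<ge> 2" and R: "region R" and b: "b \<in> height_functions"
    and w: "\<forall>e\<in>edges_at R. w e > 0"
  shows "pmf (boltzmann R b w) f =
     (if f \<in> height_functions_on R b
      then boltzmann_weight R w f / (\<Sum>h\<in>height_functions_on R b. boltzmann_weight R w h)
      else 0)"
proof -
  let ?S = "height_functions_on R b"
  let ?Z = "\<Sum>h\<in>?S. boltzmann_weight R w h"
  have fin: "finite ?S"
    using finite_height_functions_on[OF card R] .
  have "b \<in> ?S"
    using b by (simp add: height_functions_on_def)
  have pos: "boltzmann_weight R w h > 0" for h
    unfolding boltzmann_weight_def by (rule prod_pos) (use w in auto)
  have Z: "?Z > 0"
    using fin \<open>b \<in> ?S\<close> pos by (intro sum_pos) auto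
  let ?p = "\<lambda>f. if f \<in> ?S then boltzmann_weight R w f / ?Z else 0"
  have nonneg: "?p h \<ge> 0" for h
    using pos[of h] Z by simp
  have "(\<integral>\<^sup>+ h. ennreal (?p h) \<partial>count_space UNIV) = (\<Sum>h\<in>?S. ennreal (?p h))"
    by (rule nn_integral_count_space'[OF fin]) auto
  also have "\<dots> = ennreal (\<Sum>h\<in>?S. ?p h)"
    using nonneg by (rule sum_ennreal)
  also have "(\<Sum>h\<in>?S. ?p h) = 1"
    using Z by (simp add: sum_divide_distrib[symmetric])
  finally have "(\<integral>\<^sup>+ h. ennreal (?p h) \<partial>count_space UNIV) = 1"
    by simp
  then show ?thesis
    unfolding boltzmann_def by (subst pmf_embed_pmf) (use nonneg in auto)
qed

end

theory Submission
  imports Defs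
begin

text \<open>
  Write \<open>g = f\<^sub>1 - f\<^sub>2\<close> and \<open>n = d + 1\<close>. Along a simplicial loop each of \<open>f\<^sub>1, f\<^sub>2\<close> drops exactly once, so \<open>g\<close> is
  either constant on the loop or has exactly one step \<open>n\<close> and one step \<open>-n\<close>; in the latter case the
  two steps belong to the same \<open>g\<close>-boundary. Hence restricting the increments of \<open>g / n\<close> to a
  single boundary \<open>E\<close> gives a closed 1-form, which is exact because simplicial loops generate all
  cycles. Its potential \<open>h\<^sub>E\<close> with \<open>h\<^sub>E 0 = 0\<close> takes values in \<open>{0, \<sigma>\<^sub>E}\<close> with \<open>\<sigma>\<^sub>E = 1\<close> or \<open>\<sigma>\<^sub>E = -1\<close>, and
  \<open>E\<close> separates \<open>x\<close> from \<open>0\<close> iff \<open>h\<^sub>E x \<noteq> 0\<close>. These cuts show that the level set decomposition is a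
  tree in which distances count separating boundaries, and \<open>g = n * (\<Sum>E. h\<^sub>E)\<close>.

  By independence, the covariance is half the expectation of \<open>g x * g y\<close>. Expanding this product, a
  diagonal term \<open>h\<^sub>E x * h\<^sub>E y\<close> is the indicator that \<open>E\<close> separates both points from \<open>0\<close>. Exchanging the
  steps of \<open>f\<^sub>1\<close> and \<open>f\<^sub>2\<close> along a single boundary \<open>E\<close> is a weight-preserving involution that changes the
  sign of \<open>h\<^sub>E\<close> and of no other \<open>h\<^sub>E'\<close>, so the off-diagonal terms cancel.
\<close>


subsection \<open>Trees described by cuts\<close>

text \<open>A tree is described here by its edge cuts instead of by acyclicity:
  \<open>side e\<close> two-colours the vertices, a step of \<open>r\<close> changes exactly one
  colour, and the steps changing a given colour are one edge in its two directions. Distances then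
  count the cuts that separate the ends.\<close>

locale cut_graph =
  fixes V :: "'v set" and r :: "('v \<times> 'v) set" and side :: "'e \<Rightarrow> 'v \<Rightarrow> bool" and B :: "'e set"
  assumes sym: "sym r" and sub: "r \<subseteq> V \<times> V"
    and edge: "(a, b) \<in> r \<Longrightarrow> \<exists>e\<in>B. \<forall>e'\<in>B. side e' a \<noteq> side e' b \<longleftrightarrow> e' = e"
    and uniq: "\<lbrakk>(a, b) \<in> r; (c, d) \<in> r; e \<in> B; side e a \<noteq> side e b; side e c \<noteq> side e d;
      side e a = side e c\<rbrakk> \<Longrightarrow> a = c \<and> b = d"
    and conn: "\<lbrakk>a \<in> V; b \<in> V\<rbrakk> \<Longrightarrow> (a, b) \<in> r\<^sup>*"
begin

definition sep :: "'v \<Rightarrow> 'v \<Rightarrow> 'e set" where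
  "sep u v = {e \<in> B. side e u \<noteq> side e v}"

lemma sep_edge:
  assumes "(a, b) \<in> r" obtains e where "e \<in> B" "sep a b = {e}"
  using edge[OF assms] by (auto simp: sep_def)

text \<open>A discrete intermediate value argument. The step found leaves the side of the start, and
  this direction is what \<open>uniq\<close> needs to identify it.\<close>

lemma sep_crossed:
  assumes "successively (\<lambda>a b. (a, b) \<in> r) p" "p \<noteq> []" "e \<in> sep (hd p) (last p)"
  shows "\<exists>c d. c \<in> set p \<and> d \<in> set p \<and> (c, d) \<in> r \<and> side e c = side e (hd p) \<and> side e d \<noteq> side e c"
  using assms
proof (induction p)
  case (Cons a p)
  show ?case
  proof (cases p)
    case Nil
    then show ?thesis using Cons.prems by (simp add: sep_def)
  next
    case (Cons b q)
    have *: "(a, b) \<in> r" "successively (\<lambda>a b. (a, b) \<in> r) p"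
      using Cons Cons.prems by auto
    show ?thesis
    proof (cases "side e a = side e b")
      case True
      then have "e \<in> sep (hd p) (last p)"
        using Cons Cons.prems(3) by (simp add: sep_def)
      then show ?thesis
        using Cons.IH[OF *(2)] Cons True by auto
    next
      case False
      then show ?thesis using * Cons by auto
    qed
  qed
qed simp

lemma path_Cons:
  assumes "graph_path r u v (a # p)" "p \<noteq> []"
  shows "a = u" "(u, hd p) \<in> r" "graph_path r (hd p) v p" "u \<notin> set p"
  using assms by (auto simp: graph_path_def successively_Cons)

text \<open>By \<open>uniq\<close>, a cut crossed by the first step can be crossed back only by the
  reversed first step, and that would revisit \<open>u\<close>.\<close>

lemma path_sep_Cons:
  assumes "graph_path r u v (a # p)" "p \<noteq> []" "e \<in> sep u (hd p)"
  shows "e \<notin> sep (hd p) v"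
proof
  assume "e \<in> sep (hd p) v"
  moreover have p: "graph_path r (hd p) v p" and r: "(u, hd p) \<in> r" and u: "u \<notin> set p"
    using path_Cons[OF assms(1,2)] by auto
  ultimately obtain c d where cd: "d \<in> set p" "(c, d) \<in> r"
    "side e c = side e (hd p)" "side e d \<noteq> side e c"
    using sep_crossed[of p e] by (auto simp: graph_path_def)
  have e: "e \<in> B" "side e u \<noteq> side e (hd p)"
    using assms(3) by (auto simp: sep_def)
  have "(hd p, u) \<in> r"
    using r sym by (auto dest: symD)
  then have "d = u"
    using uniq[of "hd p" u c d e] cd e by blast
  then show False
    using cd u by simp
qed

text \<open>Each step of a path toggles one cut, and no cut is toggled twice.\<close>

lemma path_card_sep:
  "graph_path r u v p \<Longrightarrow> finite (sep u v) \<and> Suc (card (sep u v)) = length p"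
proof (induction p arbitrary: u)
  case (Cons a p)
  show ?case
  proof (cases "p = []")
    case True
    then show ?thesis using Cons.prems by (auto simp: graph_path_def sep_def)
  next
    case False
    note pc = path_Cons[OF Cons.prems False]
    obtain e where e: "e \<in> B" "sep u (hd p) = {e}"
      using sep_edge[OF pc(2)] .
    have IH: "finite (sep (hd p) v)" "Suc (card (sep (hd p) v)) = length p"
      using Cons.IH[OF pc(3)] by auto
    have "e \<notin> sep (hd p) v"
      using path_sep_Cons[OF Cons.prems False] e by simp
    moreover have "sep u v = sep u (hd p) \<union> sep (hd p) v - sep u (hd p) \<inter> sep (hd p) v"
      by (auto simp: sep_def)
    ultimately have "e \<notin> sep (hd p) v" "sep u v = insert e (sep (hd p) v)"
      using e by auto
    then show ?thesis
      using IH by simp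
  qed
qed (simp add: graph_path_def)

lemma path_append:
  assumes "graph_path r u v (p @ c # q)"
  shows "graph_path r u c (p @ [c])" "graph_path r c v (c # q)"
  using assms by (auto simp: graph_path_def successively_append_iff hd_append split: if_splits)

text \<open>Lengths add up when a path is split at \<open>c\<close>. By \<open>path_card_sep\<close>
  the symmetric difference \<open>sep u v\<close> of the cuts of the two pieces is therefore as
  large as both together, so the pieces share no cut.\<close>

lemma path_sep_mono:
  assumes "graph_path r u v p" "c \<in> set p"
  shows "sep u c \<subseteq> sep u v"
proof -
  obtain q q' where p: "p = q @ c # q'"
    using assms(2) by (meson split_list)
  note pa = path_append[OF assms(1)[unfolded p]]
  have fin: "finite (sep u c)" "finite (sep c v)"
    and card: "card (sep u v) = card (sep u c) + card (sep c v)"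
    using path_card_sep[OF assms(1)] path_card_sep[OF pa(1)] path_card_sep[OF pa(2)] p by auto
  have "sep u v = (sep u c \<union> sep c v) - (sep u c \<inter> sep c v)"
    by (auto simp: sep_def)
  then have "card (sep u v) = card (sep u c \<union> sep c v) - card (sep u c \<inter> sep c v)"
    using fin by (simp add: card_Diff_subset Int_commute le_infI1)
  moreover have "card (sep u c \<union> sep c v) + card (sep u c \<inter> sep c v) = card (sep u c) + card (sep c v)"
    using card_Un_Int[OF fin] by simp
  moreover have "card (sep u c \<inter> sep c v) \<le> card (sep u c \<union> sep c v)"
    using fin by (intro card_mono) auto
  ultimately have "card (sep u c \<inter> sep c v) = 0"
    using card by linarith
  then have "sep u c \<inter> sep c v = {}"
    using fin by simp
  then show ?thesis
    by (auto simp: sep_def)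
qed

text \<open>If the paths left \<open>u\<close> along different edges, the cut crossed by the first
  step of one would still have to be crossed by the other. Only the edge from \<open>u\<close>
  crosses it in that direction, and a path does not return to \<open>u\<close>.\<close>

lemma path_unique:
  "graph_path r u v p \<Longrightarrow> graph_path r u v q \<Longrightarrow> p = q"
proof (induction p arbitrary: u q)
  case (Cons a p)
  obtain a' q' where q: "q = a' # q'"
    using Cons.prems(2) by (cases q) (auto simp: graph_path_def)
  have a: "a = u" "a' = u"
    using Cons.prems q by (auto simp: graph_path_def)
  show ?case
  proof (cases "p = [] \<or> q' = []")
    case True
    moreover have "last (a # p) = v" "last (a' # q') = v"
      using Cons.prems unfolding q graph_path_def by blast+
    ultimately have "u = v"
      using a by (metis last_ConsL)
    then show ?thesis
      using Cons.prems a q last_in_set by (fastforce simp: graph_path_def split: if_splits)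
  next
    case False
    note pc = path_Cons[OF Cons.prems(1)] and qc = path_Cons[OF Cons.prems(2)[unfolded q]]
    have r: "(u, hd p) \<in> r" "(u, hd q') \<in> r"
      using pc qc False by auto
    have "hd p = hd q'"
    proof (rule ccontr)
      assume ne: "hd p \<noteq> hd q'"
      obtain e where e: "e \<in> B" "sep u (hd p) = {e}"
        using sep_edge[OF r(1)] .
      then have flip: "side e u \<noteq> side e (hd p)"
        by (auto simp: sep_def)
      have "e \<in> sep u v"
        using path_sep_mono[OF Cons.prems(1), of "hd p"] False e by auto
      moreover have same: "side e u = side e (hd q')"
        using uniq[OF r e(1) flip] ne by auto
      ultimately have "e \<in> sep (hd q') v"
        by (auto simp: sep_def)
      then obtain c d where "c \<in> set q'" "(c, d) \<in> r" "side e c = side e u" "side e d \<noteq> side e c"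
        using sep_crossed[of q' e] qc(3) False same by (auto simp: graph_path_def)
      then show False
        using uniq[OF r(1) _ e(1) flip, of c d] qc(4) False by blast
    qed
    then have "p = q'"
      using Cons.IH[of "hd p" q'] pc(3) qc(3) False by simp
    then show ?thesis
      using a q by simp
  qed
qed (simp add: graph_path_def)

lemma path_exists:
  assumes "u \<in> V" "v \<in> V" shows "\<exists>p. graph_path r u v p"
  using conn[OF assms]
proof (induction rule: rtrancl_induct)
  case base
  show ?case by (rule exI[of _ "[u]"]) (simp add: graph_path_def)
next
  case (step y z)
  then obtain p where p: "graph_path r u y p" by blast
  show ?case
  proof (cases "z \<in> set p")
    case True
    then obtain q q' where "p = q @ z # q'"
      by (meson split_list)
    then show ?thesis
      using p path_append(1) by blast
  next
    case False
    then have "graph_path r u z (p @ [z])"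
      using p step.hyps(2) by (auto simp: graph_path_def successively_append_iff)
    then show ?thesis by blast
  qed
qed

lemma tree_path:
  assumes "u \<in> V" "v \<in> V" shows "graph_path r u v (tree_path r u v)"
proof -
  have "\<exists>!p. graph_path r u v p"
    using path_exists[OF assms] path_unique by blast
  then show ?thesis
    unfolding tree_path_def by (rule theI')
qed

lemma path_relpow:
  "graph_path r u v p \<Longrightarrow> (u, v) \<in> r ^^ (length p - 1)"
proof (induction p arbitrary: u)
  case (Cons a p)
  show ?case
  proof (cases "p = []")
    case True
    then show ?thesis using Cons.prems by (auto simp: graph_path_def)
  next
    case False
    note pc = path_Cons[OF Cons.prems False]
    have "(u, v) \<in> r ^^ Suc (length p - 1)"
      using pc(2) Cons.IH[OF pc(3)] by (rule relpow_Suc_I2)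
    then show ?thesis using False by (cases p) auto
  qed
qed (simp add: graph_path_def)

text \<open>This is the lower bound on distances: the walk may repeat vertices, and every step
  changes the set of separating cuts by one element.\<close>

lemma relpow_card_sep:
  "(u, v) \<in> r ^^ k \<Longrightarrow> finite (sep u v) \<and> card (sep u v) \<le> k"
proof (induction k arbitrary: v)
  case 0
  then show ?case by (simp add: sep_def)
next
  case (Suc k)
  then obtain t where t: "(u, t) \<in> r ^^ k" "(t, v) \<in> r" by auto
  obtain e where e: "e \<in> B" "sep t v = {e}"
    using sep_edge[OF t(2)] .
  have "sep u v \<subseteq> insert e (sep u t)"
    using e by (auto simp: sep_def)
  moreover have "finite (sep u t)" "card (sep u t) \<le> k"
    using Suc.IH[OF t(1)] by auto
  ultimately show ?case
    using card_mono[of "insert e (sep u t)" "sep u v"] card_insert_le_m1[of "Suc k" "sep u t" e]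
    by (auto intro: finite_subset)
qed

lemma graph_dist_eq:
  assumes "u \<in> V" "v \<in> V" shows "graph_dist r u v = card (sep u v)"
proof -
  obtain p where p: "graph_path r u v p"
    using path_exists[OF assms] by blast
  have "(u, v) \<in> r ^^ card (sep u v)"
    using path_relpow[OF p] path_card_sep[OF p] by (metis diff_Suc_1)
  then show ?thesis
    unfolding graph_dist_def by (rule Least_equality) (use relpow_card_sep in blast)
qed

text \<open>A cut separating \<open>u\<close> from both \<open>v\<close> and \<open>w\<close> is
  crossed by both paths along the same edge, so the far end of that edge is common to the paths and
  lies at or before \<open>z\<close>.\<close>

lemma last_common_sep:
  fixes u v w :: 'v
  defines "z \<equiv> last (filter (\<lambda>c. c \<in> set (tree_path r u w)) (tree_path r u v))"
  assumes "u \<in> V" "v \<in> V" "w \<in> V"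
  shows "z \<in> V" "sep u z = sep u v \<inter> sep u w"
proof -
  let ?p = "tree_path r u v" and ?q = "tree_path r u w"
  have p: "graph_path r u v ?p" and q: "graph_path r u w ?q"
    using tree_path assms by auto
  have u: "u \<in> set ?p" "u \<in> set ?q"
    using p q hd_in_set by (fastforce simp: graph_path_def)+
  then have "\<exists>c\<in>set ?p. c \<in> set ?q" by blast
  then obtain s c t where sct: "?p = s @ c # t" "c \<in> set ?q" "\<forall>c\<in>set t. c \<notin> set ?q"
    using split_list_last_prop[of ?p "\<lambda>c. c \<in> set ?q"] by blast
  have c: "z = c"
    using sct by (simp add: z_def filter_empty_conv)
  note pa = path_append[OF p[unfolded sct(1)]]
  have sz: "sep u z \<subseteq> sep u v \<inter> sep u w"
    using path_sep_mono[OF p, of c] path_sep_mono[OF q, of c] sct c by simp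
  moreover have "e \<in> sep u z" if ew: "e \<in> sep u v" "e \<in> sep u w" for e
  proof -
    have e: "e \<in> B" using ew by (simp add: sep_def)
    obtain a b where ab: "b \<in> set ?p" "(a, b) \<in> r" "side e a = side e u" "side e b \<noteq> side e a"
      using sep_crossed[of ?p e] p ew by (auto simp: graph_path_def)
    obtain a' b' where ab': "b' \<in> set ?q" "(a', b') \<in> r" "side e a' = side e u" "side e b' \<noteq> side e a'"
      using sep_crossed[of ?q e] q ew by (auto simp: graph_path_def)
    have "b = b'"
      using uniq[OF ab(2) ab'(2) e] ab ab' by auto
    then have "b \<in> set (s @ [c])"
      using sct ab(1) ab'(1) by auto
    then have "sep u b \<subseteq> sep u z"
      using path_sep_mono[OF pa(1)] c by blast
    then show ?thesis
      using ab e by (auto simp: sep_def)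
  qed
  ultimately show "sep u z = sep u v \<inter> sep u w" by blast
  have "(u, z) \<in> r ^^ (length (s @ [c]) - 1)"
    using path_relpow[OF pa(1)] c by simp
  then have "(u, z) \<in> r\<^sup>*"
    by (rule relpow_imp_rtrancl)
  then show "z \<in> V"
    using sub assms(2) by (cases rule: rtranclE) auto
qed

end


subsection \<open>Closed 1-forms on the simplicial lattice\<close>

lemma lattice_0 [simp]: "0 \<in> simplicial_lattice"
  unfolding simplicial_lattice_def by (rule image_eqI[of _ _ 0]) (auto simp: proj_H_def)

lemma gen_component: "(gen i :: real ^ 'n) $ k = (if k = i then 1 else 0) - 1 / real CARD('n)"
  by (simp add: gen_eq all_ones_nth axis_def)

lemma sum_gen: "(\<Sum>i\<in>UNIV. gen i :: real ^ 'n) = 0"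
  by (simp add: vec_eq_iff gen_component sum_subtractf)

lemma gen_inject: "(gen i :: real ^ 'n) = gen j \<longleftrightarrow> i = j"
proof
  assume "(gen i :: real ^ 'n) = gen j"
  then have "(gen i :: real ^ 'n) $ i = gen j $ i" by simp
  then show "i = j" by (simp add: gen_component split: if_splits)
qed simp

lemma gen_add_gen_nonzero:
  assumes "CARD('n) \<ge> 3" shows "(gen i :: real ^ 'n) + gen j \<noteq> 0"
proof
  assume 0: "(gen i :: real ^ 'n) + gen j = 0"
  have "card {i, j} < CARD('n)"
    using assms card_insert_le_m1[of 2 "{j}" i] by simp
  then obtain k where "k \<notin> {i, j}"
    by (metis UNIV_eq_I less_irrefl)
  then show False
    using arg_cong[OF 0, of "\<lambda>v. v $ k"] by (simp add: gen_component)
qed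

text \<open>No two generators cancel when d >= 2, because a coordinate different from both indices
  is nonzero in their sum. An edge thus determines its base point and its generator, so membership
  in \<open>down_edges\<close> can be read off from a single step.\<close>

lemma lattice_edge_eq_iff:
  assumes "CARD('n) \<ge> 3"
  shows "{x, x + gen i} = {y, y + gen j} \<longleftrightarrow> x = (y :: real ^ 'n) \<and> i = j"
proof -
  have "x = y + gen j \<Longrightarrow> x + gen i \<noteq> y"
    using gen_add_gen_nonzero[OF assms, of j i] by (auto simp: add.assoc)
  then show ?thesis
    by (auto simp: doubleton_eq_iff gen_inject)
qed

lemma lattice_edgeI [intro]: "x \<in> simplicial_lattice \<Longrightarrow> {x, x + gen i} \<in> lattice_edges"
  by (auto simp: lattice_edges_def)

lemma lattice_edgeE:
  assumes "e \<in> lattice_edges"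
  obtains x i where "x \<in> simplicial_lattice" "e = {x, x + gen i}"
  using assms by (auto simp: lattice_edges_def)

lemma proj_H_scaleR: "proj_H (c *\<^sub>R v) = c *\<^sub>R proj_H v"
  by (simp add: proj_H_def scaleR_diff_right)

lemma proj_H_sum: "proj_H (\<Sum>i\<in>A. f i) = (\<Sum>i\<in>A. proj_H (f i))"
  by (induction A rule: infinite_finite_induct) (simp_all add: proj_H_add, simp_all add: proj_H_def)

lemma lattice_nat_coordinates:
  fixes x :: "real ^ 'n"
  assumes "x \<in> simplicial_lattice"
  shows "\<exists>c :: 'n \<Rightarrow> nat. x = (\<Sum>i\<in>UNIV. real (c i) *\<^sub>R gen i)"
proof -
  obtain v where v: "\<forall>i. v $ i \<in> \<int>" "x = proj_H v"
    using assms by (auto simp: simplicial_lattice_def)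
  have "\<forall>i. \<exists>k. v $ i = of_int k"
    using v(1) by (auto elim: Ints_cases)
  then obtain a where a: "\<And>i. v $ i = of_int (a i)"
    by (auto simp: choice_iff)
  \<comment> \<open>Adding \<open>m\<close> to every coordinate makes all of them nonnegative, and
    it leaves the point unchanged because the generators sum to zero.\<close>
  define m where "m = Max (range (\<lambda>i. \<bar>a i\<bar>))"
  have m: "a i + m \<ge> 0" for i
  proof -
    have "\<bar>a i\<bar> \<le> m"
      unfolding m_def by (rule Max_ge) auto
    then show ?thesis by linarith
  qed
  have v_eq: "v = (\<Sum>i\<in>UNIV. of_int (a i) *\<^sub>R axis i 1)"
    using basis_expansion[of v] by (simp add: a scalar_mult_eq_scaleR)
  have "x = (\<Sum>i\<in>UNIV. of_int (a i) *\<^sub>R gen i)"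
    by (simp add: v(2) v_eq proj_H_sum proj_H_scaleR gen_def)
  also have "\<dots> = (\<Sum>i\<in>UNIV. of_int (a i) *\<^sub>R gen i) + of_int m *\<^sub>R (\<Sum>i\<in>UNIV. gen i)"
    by (simp add: sum_gen)
  also have "\<dots> = (\<Sum>i\<in>UNIV. real (nat (a i + m)) *\<^sub>R gen i)"
    using m by (simp add: scaleR_sum_right sum.distrib[symmetric] scaleR_left_distrib)
  finally show ?thesis by (intro exI[of _ "\<lambda>i. nat (a i + m)"])
qed

text \<open>Forward steps alone suffice, since nonnegative coefficients already reach every lattice
  point.\<close>

lemma lattice_induct [consumes 1, case_names zero step]:
  fixes x :: "real ^ 'n"
  assumes "x \<in> simplicial_lattice" "P 0"
    and step: "\<And>x i. x \<in> simplicial_lattice \<Longrightarrow> P x \<Longrightarrow> P (x + gen i)"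
  shows "P x"
proof -
  have ray: "y + real k *\<^sub>R gen i \<in> simplicial_lattice \<and> P (y + real k *\<^sub>R gen i)"
    if "y \<in> simplicial_lattice" "P y" for y k i
    using that
  proof (induction k)
    case (Suc k)
    have "y + real (Suc k) *\<^sub>R gen i = (y + real k *\<^sub>R gen i) + gen i"
      by (simp add: algebra_simps)
    then show ?case
      using Suc step lattice_add_gen by metis
  qed simp
  have "(\<Sum>i\<in>A. real (c i) *\<^sub>R gen i) \<in> simplicial_lattice \<and> P (\<Sum>i\<in>A. real (c i) *\<^sub>R gen i)"
    if "finite A" for A :: "'n set" and c :: "'n \<Rightarrow> nat"
    using that
  proof induction
    case (insert i A)
    then show ?case
      using ray[of "\<Sum>i\<in>A. real (c i) *\<^sub>R gen i" "c i" i] by (simp add: add.commute)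
  qed (use assms in simp)
  then show ?thesis
    using lattice_nat_coordinates[OF assms(1)] by (metis finite_class.finite_UNIV)
qed

section \<open>Sums of 1-forms along lattice walks\<close>

fun walk_sum :: "(real ^ 'n \<Rightarrow> 'n::finite \<Rightarrow> int) \<Rightarrow> real ^ 'n \<Rightarrow> 'n list \<Rightarrow> int" where
  "walk_sum \<omega> x [] = 0"
| "walk_sum \<omega> x (i # is) = \<omega> x i + walk_sum \<omega> (x + gen i) is"

definition walk_end :: "real ^ 'n \<Rightarrow> 'n::finite list \<Rightarrow> real ^ 'n" where
  "walk_end x is = x + sum_list (map gen is)"

lemma walk_end_simps [simp]:
  "walk_end x [] = x" "walk_end x (i # is) = walk_end (x + gen i) is"
  "walk_end x (is @ js) = walk_end (walk_end x is) js"
  by (simp_all add: walk_end_def add.assoc)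

lemma walk_end_lattice: "x \<in> simplicial_lattice \<Longrightarrow> walk_end x is \<in> simplicial_lattice"
  by (induction "is" arbitrary: x) (auto simp: lattice_add_gen)

lemma walk_sum_append: "walk_sum \<omega> x (is @ js) = walk_sum \<omega> x is + walk_sum \<omega> (walk_end x is) js"
  by (induction "is" arbitrary: x) auto

lemma walk_sum_conv_sum:
  "walk_sum \<omega> x is = (\<Sum>k<length is. \<omega> (walk_end x (take k is)) (is ! k))"
  by (induction "is" arbitrary: x) (simp_all add: sum.lessThan_Suc_shift del: sum.lessThan_Suc)

text \<open>The lists quantified over are the step sequences of the simplicial loops.\<close>

definition closed_form :: "(real ^ 'n \<Rightarrow> 'n::finite \<Rightarrow> int) \<Rightarrow> bool" where
  "closed_form \<omega> \<longleftrightarrow>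
     (\<forall>x\<in>simplicial_lattice. \<forall>is. distinct is \<and> set is = UNIV \<longrightarrow> walk_sum \<omega> x is = 0)"

text \<open>The loops \<open>i # j # ks\<close> and \<open>j # i # ks\<close> agree after two steps,
  so their difference is the sum around the parallelogram spanned by \<open>gen i\<close> and
  \<open>gen j\<close>.\<close>

lemma closed_form_swap:
  fixes \<omega> :: "real ^ 'n \<Rightarrow> 'n \<Rightarrow> int"
  assumes "closed_form \<omega>" "x \<in> simplicial_lattice"
  shows "\<omega> x i + \<omega> (x + gen i) j = \<omega> x j + \<omega> (x + gen j) i"
proof (cases "i = j")
  case False
  obtain ks where ks: "distinct ks" "set ks = UNIV - {i, j}"
    using finite_distinct_list[of "UNIV - {i, j}"] by auto
  have "walk_sum \<omega> x is = 0" if "distinct is" "set is = UNIV" for "is"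
    using assms that by (simp add: closed_form_def)
  from this[of "i # j # ks"] this[of "j # i # ks"]
  have "walk_sum \<omega> x (i # j # ks) = 0" "walk_sum \<omega> x (j # i # ks) = 0"
    using ks False by auto
  then show ?thesis
    by (simp add: add.assoc add.commute[of "gen j" "gen i"])
qed simp

lemma walk_sum_move:
  assumes "closed_form \<omega>" "x \<in> simplicial_lattice"
  shows "walk_sum \<omega> x (is @ i # js) = walk_sum \<omega> x (i # is @ js)"
  using assms(2)
proof (induction "is" arbitrary: x)
  case (Cons k ks)
  have "walk_sum \<omega> x ((k # ks) @ i # js) = \<omega> x k + walk_sum \<omega> (x + gen k) (i # ks @ js)"
    using Cons lattice_add_gen by fastforce
  also have "\<dots> = walk_sum \<omega> x (i # (k # ks) @ js)"
    using closed_form_swap[OF assms(1) Cons.prems, of k i] by (simp add: add.assoc add.commute[of "gen i"])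
  finally show ?case .
qed simp

text \<open>Any reordering is carried out by locating the first step of one walk in the other and
  moving it to the front.\<close>

lemma walk_sum_mset:
  assumes "closed_form \<omega>" "x \<in> simplicial_lattice" "mset is = mset js"
  shows "walk_sum \<omega> x is = walk_sum \<omega> x js"
  using assms(2,3)
proof (induction "is" arbitrary: x js)
  case (Cons i "is")
  have "i \<in> set js"
    using Cons.prems(2) by (metis list.set_intros(1) set_mset_mset)
  then obtain as bs where js: "js = as @ i # bs"
    by (meson split_list)
  then have "mset is = mset (as @ bs)"
    using Cons.prems by simp
  then have "walk_sum \<omega> (x + gen i) is = walk_sum \<omega> (x + gen i) (as @ bs)"
    by (intro Cons.IH lattice_add_gen Cons.prems)
  then show ?case
    using walk_sum_move[OF assms(1) Cons.prems(1)] js by simp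
qed simp

lemma walk_end_count: "walk_end x is = x + (\<Sum>i\<in>UNIV. real (count (mset is) i) *\<^sub>R gen i)"
proof (induction "is" arbitrary: x)
  case (Cons i "is")
  have "(\<Sum>j\<in>UNIV. real (count (mset (i # is)) j) *\<^sub>R gen j) =
      (\<Sum>j\<in>UNIV. (if j = i then gen j else 0) + real (count (mset is) j) *\<^sub>R gen j)"
    by (intro sum.cong) (auto simp: algebra_simps)
  also have "\<dots> = gen i + (\<Sum>j\<in>UNIV. real (count (mset is) j) *\<^sub>R gen j)"
    by (simp add: sum.distrib)
  finally show ?case
    using Cons[of "x + gen i"] by simp
qed simp

text \<open>Consequently the coefficients of a lattice point are determined up to a common additive
  constant, which is how the step counts of two walks with the same ends are compared.\<close>

lemma sum_gen_component:
  "(\<Sum>i\<in>UNIV. c i *\<^sub>R gen i :: real ^ 'n) $ k = c k - (\<Sum>i\<in>UNIV. c i) / real CARD('n)"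
proof -
  have "(\<Sum>i\<in>UNIV. c i *\<^sub>R gen i :: real ^ 'n) $ k =
      (\<Sum>i\<in>UNIV. (if i = k then c i else 0) - c i / real CARD('n))"
    unfolding sum_component by (intro sum.cong) (auto simp: gen_component right_diff_distrib)
  also have "\<dots> = c k - (\<Sum>i\<in>UNIV. c i) / real CARD('n)"
    by (simp add: sum_subtractf sum_divide_distrib)
  finally show ?thesis .
qed

text \<open>
  Two walks with the same ends use every generator equally often, up to a common multiple of full
  loops, so appending loops to the shorter walk reduces the claim to a reordering of steps.
\<close>

lemma walk_sum_same_end:
  fixes x :: "real ^ 'n"
  assumes cl: "closed_form \<omega>" and x: "x \<in> simplicial_lattice"
    and eq: "walk_end x is = walk_end x js"
  shows "walk_sum \<omega> x is = walk_sum \<omega> x js"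
proof -
  obtain ks :: "'n list" where ks: "distinct ks" "set ks = UNIV"
    using finite_distinct_list[of "UNIV :: 'n set"] by auto
  define loops where "loops m = concat (replicate m ks)" for m
  have cks: "count (mset ks) i = 1" for i
    using ks by (simp add: distinct_count_atmost_1)
  have count_loops: "count (mset (loops m)) i = m" for m i
    by (induction m) (simp_all add: loops_def cks)
  have endks: "walk_end y ks = y" for y :: "real ^ 'n"
    using cks sum_gen by (simp add: walk_end_count)
  have sum_loops: "walk_sum \<omega> y (loops m) = 0" if "y \<in> simplicial_lattice" for y m
    using cl that ks by (induction m) (simp_all add: loops_def walk_sum_append endks closed_form_def)
  have le: "walk_sum \<omega> x as = walk_sum \<omega> x bs"
    if "walk_end x as = walk_end x bs" "length as \<le> length bs" for as bs
  proof -
    have D: "(\<Sum>i\<in>UNIV. real (count (mset as) i) *\<^sub>R gen i) = (\<Sum>i\<in>UNIV. real (count (mset bs) i) *\<^sub>R gen i :: real ^ 'n)"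
      using that(1) by (simp add: walk_end_count)
    \<comment> \<open>\<open>q\<close> is the number of full loops by which \<open>bs\<close>
      exceeds \<open>as\<close>. As a quotient it is only real at first; it is an integer because
      every count differs by it, and nonnegative because of the lengths.\<close>
    define q where "q = (\<Sum>i\<in>UNIV. real (count (mset bs) i)) / real CARD('n) - (\<Sum>i\<in>UNIV. real (count (mset as) i)) / real CARD('n)"
    have diff: "real (count (mset bs) k) - real (count (mset as) k) = q" for k
      using arg_cong[OF D, of "\<lambda>v. v $ k"] unfolding sum_gen_component q_def by linarith
    have len: "(\<Sum>i\<in>UNIV. real (count (mset cs) i)) = real (length cs)" for cs :: "'n list"
    proof -
      have "(\<Sum>i\<in>UNIV. count (mset cs) i) = (\<Sum>i\<in>set cs. count (mset cs) i)"
        by (rule sum.mono_neutral_right) (auto simp: not_in_iff[symmetric])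
      also have "\<dots> = length cs"
        using size_multiset_overloaded_eq[of "mset cs"] by simp
      finally show ?thesis by (simp flip: of_nat_sum)
    qed
    have "q \<ge> 0"
      using that(2) by (simp add: q_def len divide_right_mono)
    then have ge: "count (mset as) k \<le> count (mset bs) k" for k
      using diff[of k] by simp
    define m where "m = nat \<lfloor>q\<rfloor>"
    have "count (mset bs) k = count (mset as) k + m" for k
    proof -
      have "q = real (count (mset bs) k - count (mset as) k)"
        using diff[of k] ge[of k] by simp
      then have "m = count (mset bs) k - count (mset as) k"
        unfolding m_def by (simp only: floor_of_nat nat_int)
      then show ?thesis using ge[of k] by simp
    qed
    then have "mset bs = mset (as @ loops m)"
      by (intro multiset_eqI) (simp add: count_loops)
    then have "walk_sum \<omega> x bs = walk_sum \<omega> x (as @ loops m)"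
      by (rule walk_sum_mset[OF cl x])
    then show ?thesis
      by (simp add: walk_sum_append sum_loops walk_end_lattice x)
  qed
  show ?thesis
    using le[of "is" js] le[of js "is"] eq by (cases "length is \<le> length js") auto
qed

text \<open>The value off the lattice is \<open>0\<close>, so that subtracting a potential preserves extensionality of
  height functions.\<close>

definition potential :: "(real ^ 'n \<Rightarrow> 'n::finite \<Rightarrow> int) \<Rightarrow> real ^ 'n \<Rightarrow> int" where
  "potential \<omega> x =
     (if x \<in> simplicial_lattice then walk_sum \<omega> 0 (SOME is. walk_end 0 is = x) else 0)"

lemma walk_end_surj:
  assumes "x \<in> simplicial_lattice" shows "\<exists>is. walk_end 0 is = x"
  using assms
proof (induction rule: lattice_induct)
  case zero
  show ?case by (rule exI[of _ "[]"]) simp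
next
  case (step x i)
  then obtain "is" where "walk_end 0 is = x" by blast
  then show ?case by (intro exI[of _ "is @ [i]"]) simp
qed

lemma potential_walk_end:
  assumes "closed_form \<omega>" shows "potential \<omega> (walk_end 0 is) = walk_sum \<omega> 0 is"
proof -
  have "walk_end 0 (SOME js. walk_end 0 js = walk_end 0 is) = walk_end 0 is"
    by (rule someI) simp
  then show ?thesis
    using walk_sum_same_end[OF assms lattice_0, of "SOME js. walk_end 0 js = walk_end 0 is" "is"]
    by (simp add: potential_def walk_end_lattice)
qed

lemma potential_0: "closed_form \<omega> \<Longrightarrow> potential \<omega> 0 = 0"
  using potential_walk_end[of \<omega> "[]"] by simp

lemma potential_step:
  assumes "closed_form \<omega>" "x \<in> simplicial_lattice"
  shows "potential \<omega> (x + gen i) = potential \<omega> x + \<omega> x i"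
proof -
  obtain "is" where x: "walk_end 0 is = x"
    using walk_end_surj[OF assms(2)] by blast
  have "walk_end 0 (is @ [i]) = x + gen i"
    using x by simp
  then show ?thesis
    using potential_walk_end[OF assms(1), of "is"] potential_walk_end[OF assms(1), of "is @ [i]"] x
    by (simp add: walk_sum_append)
qed

lemma potential_off: "x \<notin> simplicial_lattice \<Longrightarrow> potential \<omega> x = 0"
  by (simp add: potential_def)

lemma lattice_fun_eqI:
  fixes F G :: "real ^ 'n \<Rightarrow> int"
  assumes "x \<in> simplicial_lattice" "F 0 = G 0"
    and "\<And>x i. x \<in> simplicial_lattice \<Longrightarrow> F (x + gen i) - F x = G (x + gen i) - G x"
  shows "F x = G x"
  using assms(1)
proof (induction rule: lattice_induct)
  case (step x i)
  then show ?case using assms(3)[of x i] by simp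
qed (rule assms)


subsection \<open>Potentials of boundaries\<close>

lemma graph_component_self: "x \<in> graph_component V r x"
  by (simp add: graph_component_def)

lemma graph_component_step:
  "\<lbrakk>y \<in> graph_component V r x; (y, z) \<in> r; y \<in> V; z \<in> V\<rbrakk> \<Longrightarrow> z \<in> graph_component V r x"
  unfolding graph_component_def by (auto intro: rtrancl_into_rtrancl)

lemma graph_component_induct [consumes 1, case_names self step]:
  assumes "y \<in> graph_component V r x" "P x"
    and "\<And>y z. \<lbrakk>P y; (y, z) \<in> r; y \<in> V; z \<in> V\<rbrakk> \<Longrightarrow> P z"
  shows "P y"
  using assms(1) unfolding graph_component_def mem_Collect_eq
  by (induction rule: rtrancl_induct) (use assms in auto)

lemma graph_component_subset: "x \<in> V \<Longrightarrow> graph_component V r x \<subseteq> V"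
proof
  fix y assume "y \<in> graph_component V r x" "x \<in> V"
  then show "y \<in> V" by (induction rule: graph_component_induct)
qed

lemma graph_component_eq:
  assumes "sym r" "y \<in> graph_component V r x"
  shows "graph_component V r y = graph_component V r x"
proof -
  have "sym ((r \<inter> V \<times> V)\<^sup>*)"
    by (intro sym_rtrancl sym_Int assms(1)) (auto simp: sym_def)
  then show ?thesis
    using assms(2) unfolding graph_component_def
    by (auto intro: rtrancl_trans dest: symD)
qed

lemma sym_edge_rel: "sym (edge_rel E)"
  by (auto simp: sym_def edge_rel_def insert_commute)

text \<open>Together with its base point, a list enumerating the index type encodes a simplicial
  loop. Steps are numbered from 0 here but from 1 in \<open>traverses\<close>.\<close>

definition loop_edge :: "real ^ 'n \<Rightarrow> 'n::finite list \<Rightarrow> nat \<Rightarrow> (real ^ 'n) set" where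
  "loop_edge x is k = {walk_end x (take k is), walk_end x (take (Suc k) is)}"

definition loop_adj :: "((real ^ 'n) set \<times> (real ^ 'n) set) set" where
  "loop_adj = {(e, e'). \<exists>s. simplicial_loop s \<and> traverses s e \<and> traverses s e'}"

lemma walk_end_take_Suc:
  "k < length is \<Longrightarrow> walk_end x (take (Suc k) is) = walk_end x (take k is) + gen (is ! k)"
  by (simp add: take_Suc_conv_app_nth)

lemma walk_end_loop:
  fixes x :: "real ^ 'n"
  assumes "distinct is" "set is = UNIV" shows "walk_end x is = x"
  using assms sum_gen by (simp add: walk_end_def sum_list_distinct_conv_sum_set)

lemma length_loop: "distinct is \<Longrightarrow> set is = (UNIV :: 'n::finite set) \<Longrightarrow> length is = CARD('n)"
  by (metis distinct_card)

lemma loop_adjI: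
  fixes x :: "real ^ 'n"
  assumes "x \<in> simplicial_lattice" "distinct is" "set is = UNIV" "k < CARD('n)" "l < CARD('n)"
  shows "(loop_edge x is k, loop_edge x is l) \<in> loop_adj"
proof -
  define s where "s k = walk_end x (take k is)" for k
  have len: "length is = CARD('n)"
    using assms length_loop by blast
  have "bij_betw (\<lambda>k. is ! (k - 1)) {1..CARD('n)} (UNIV :: 'n set)"
  proof -
    have "bij_betw (\<lambda>k. k - 1) {1..CARD('n)} {..<CARD('n)}"
      by (rule bij_betwI[of _ _ _ Suc]) auto
    moreover have "bij_betw ((!) is) {..<CARD('n)} UNIV"
      by (rule bij_betw_nth) (use assms(2,3) len in auto)
    ultimately show ?thesis
      using bij_betw_trans[of "\<lambda>k. k - 1" _ _ "(!) is"] by (simp add: comp_def)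
  qed
  moreover have "\<forall>k\<in>{1..CARD('n)}. s k = s (k - 1) + gen (is ! (k - 1))"
  proof
    fix k assume "k \<in> {1..CARD('n)}"
    then show "s k = s (k - 1) + gen (is ! (k - 1))"
      using walk_end_take_Suc[of "k - 1" "is" x] len by (cases k) (simp_all add: s_def)
  qed
  ultimately have "simplicial_loop s"
    using assms walk_end_loop[of "is" x] len unfolding simplicial_loop_def by (auto simp: s_def)
  moreover have "traverses s (loop_edge x is m)" if "m < CARD('n)" for m
    unfolding traverses_def loop_edge_def s_def by (rule bexI[of _ "Suc m"]) (use that in auto)
  ultimately show ?thesis
    using assms unfolding loop_adj_def by blast
qed

lemma loop_adjE:
  fixes e e' :: "(real ^ 'n) set"
  assumes "(e, e') \<in> loop_adj"
  obtains x "is" k l where "x \<in> simplicial_lattice" "distinct is" "set is = UNIV"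
    "k < CARD('n)" "l < CARD('n)" "e = loop_edge x is k" "e' = loop_edge x is l"
proof -
  obtain s where s: "simplicial_loop s" "traverses s e" "traverses s e'"
    using assms by (auto simp: loop_adj_def)
  obtain \<xi> where \<xi>: "bij_betw \<xi> {1..CARD('n)} (UNIV :: 'n set)"
    "\<forall>k\<in>{1..CARD('n)}. s k = s (k - 1) + gen (\<xi> k)"
    using s(1) by (auto simp: simplicial_loop_def)
  define "is" where "is = map \<xi> [1..<Suc CARD('n)]"
  have len: "length is = CARD('n)"
    by (simp add: is_def)
  have set: "{Suc 0..<Suc CARD('n)} = {Suc 0..CARD('n)}" by auto
  have "distinct is" "set is = UNIV"
    using \<xi>(1) unfolding is_def by (auto simp: distinct_map bij_betw_def set simp del: upt_Suc)
  moreover have "s 0 \<in> simplicial_lattice"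
    using s(1) by (simp add: simplicial_loop_def)
  moreover have walk: "walk_end (s 0) (take k is) = s k" if "k \<le> CARD('n)" for k
    using that
  proof (induction k)
    case (Suc k)
    then have "is ! k = \<xi> (Suc k)"
      by (simp add: is_def del: upt_Suc)
    then show ?case
      using Suc \<xi>(2) len by (simp add: walk_end_take_Suc)
  qed simp
  have "\<exists>k<CARD('n). e'' = loop_edge (s 0) is k" if tr: "traverses s e''" for e''
  proof -
    obtain k where "k \<in> {1..CARD('n)}" "e'' = {s (k - 1), s k}"
      using tr by (auto simp: traverses_def)
    then show ?thesis
      by (intro exI[of _ "k - 1"]) (auto simp: loop_edge_def walk)
  qed
  then obtain k l where "k < CARD('n)" "e = loop_edge (s 0) is k" "l < CARD('n)" "e' = loop_edge (s 0) is l"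
    using s by blast
  ultimately show ?thesis
    using that by blast
qed

lemma sym_loop_adj: "sym loop_adj"
  by (auto simp: sym_def loop_adj_def)

lemma boundaries_eq: "boundaries g = graph_components (nonconst_edges g) loop_adj"
  by (simp add: boundaries_def loop_adj_def)

lemma lower_upper_end:
  fixes g :: "real ^ 'n \<Rightarrow> int"
  assumes "g a < g b"
  shows "lower_end g {a, b} = a" "lower_end g {b, a} = a" "upper_end g {a, b} = b" "upper_end g {b, a} = b"
proof -
  show l: "lower_end g {a, b} = a"
    unfolding lower_end_def arg_min_on_def arg_min_def is_arg_min_def
    by (rule some_equality) (use assms in auto)
  show u: "upper_end g {a, b} = b"
    unfolding upper_end_def arg_max_on_def arg_max_def is_arg_max_def
    by (rule some_equality) (use assms in auto)
  show "lower_end g {b, a} = a" "upper_end g {b, a} = b"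
    using l u by (simp_all add: insert_commute)
qed

section \<open>Level sets and boundaries of a height difference\<close>

definition loop_step :: "(real ^ 'n \<Rightarrow> int) \<Rightarrow> real ^ 'n \<Rightarrow> 'n::finite list \<Rightarrow> nat \<Rightarrow> int" where
  "loop_step g x is k = g (walk_end x (take (Suc k) is)) - g (walk_end x (take k is))"

text \<open>Only the behaviour on loops is assumed, without reference to two height functions. The
  locale can thus be interpreted again for the difference obtained after an exchange along a
  boundary.\<close>

locale height_difference =
  fixes g :: "real ^ 'n \<Rightarrow> int"
  assumes card: "CARD('n) \<ge> 3"
    and loop: "\<lbrakk>x \<in> simplicial_lattice; distinct is; set is = UNIV\<rbrakk> \<Longrightarrow>
      (\<forall>k<CARD('n). loop_step g x is k = 0) \<or>
      (\<exists>p q. p < CARD('n) \<and> q < CARD('n) \<and> p \<noteq> q \<and>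
         loop_step g x is p = int CARD('n) \<and> loop_step g x is q = - int CARD('n) \<and>
         (\<forall>k<CARD('n). k \<noteq> p \<longrightarrow> k \<noteq> q \<longrightarrow> loop_step g x is k = 0))"
begin

text \<open>Every edge is the first edge of some simplicial loop.\<close>

lemma step:
  assumes "x \<in> simplicial_lattice"
  shows "g (x + gen i) - g x \<in> {0, int CARD('n), - int CARD('n)}"
proof -
  obtain ks where "distinct ks" "set ks = UNIV - {i}"
    using finite_distinct_list[of "UNIV - {i}"] by auto
  then have "distinct (i # ks)" "set (i # ks) = UNIV" by auto
  from loop[OF assms this] have "loop_step g x (i # ks) 0 \<in> {0, int CARD('n), - int CARD('n)}"
    by auto (metis zero_less_card_finite)
  then show ?thesis
    by (simp add: loop_step_def)
qed

lemma uminus_card_div: "- int CARD('n) div int CARD('n) = -1"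
  using nonzero_mult_div_cancel_right[of "int CARD('n)" "-1"] by simp

lemma nonconst_iff:
  "x \<in> simplicial_lattice \<Longrightarrow> {x, x + gen i} \<in> nonconst_edges g \<longleftrightarrow> g (x + gen i) \<noteq> g x"
  by (auto simp: nonconst_edges_def)

lemma nonconst_ends:
  assumes "e \<in> nonconst_edges g"
  shows "e = {lower_end g e, upper_end g e}" "lower_end g e \<in> simplicial_lattice"
    "upper_end g e \<in> simplicial_lattice" "g (upper_end g e) = g (lower_end g e) + int CARD('n)"
proof -
  have "e \<in> lattice_edges"
    using assms by (simp add: nonconst_edges_def)
  then obtain x i where x: "x \<in> simplicial_lattice" "e = {x, x + gen i}"
    by (rule lattice_edgeE)
  have "g (x + gen i) \<noteq> g x"
    using assms x nonconst_iff by simp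
  then have "g (x + gen i) = g x + int CARD('n) \<or> g x = g (x + gen i) + int CARD('n)"
    using step[OF x(1), of i] by auto
  then have "\<exists>a b. e = {a, b} \<and> g b = g a + int CARD('n) \<and> a \<in> simplicial_lattice \<and>
      b \<in> simplicial_lattice"
  proof
    assume "g (x + gen i) = g x + int CARD('n)"
    then show ?thesis
      using x lattice_add_gen[OF x(1)] by blast
  next
    assume "g x = g (x + gen i) + int CARD('n)"
    then show ?thesis
      using x lattice_add_gen[OF x(1)] by (intro exI[of _ "x + gen i"] exI[of _ x]) auto
  qed
  then obtain a b where ab: "e = {a, b}" "g b = g a + int CARD('n)" "a \<in> simplicial_lattice"
    "b \<in> simplicial_lattice"
    by blast
  have "g a < g b"
    using ab card by simp
  then have "lower_end g e = a" "upper_end g e = b"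
    using ab(1) lower_upper_end by auto
  then show "e = {lower_end g e, upper_end g e}" "lower_end g e \<in> simplicial_lattice"
    "upper_end g e \<in> simplicial_lattice" "g (upper_end g e) = g (lower_end g e) + int CARD('n)"
    using ab by auto
qed

lemma level_set_self: "x \<in> level_set g x"
  unfolding level_set_def by (rule graph_component_self)

lemma level_set_eq: "y \<in> level_set g x \<Longrightarrow> level_set g y = level_set g x"
  unfolding level_set_def by (rule graph_component_eq[OF sym_edge_rel])

lemma level_set_step:
  assumes "x \<in> simplicial_lattice" "g (x + gen i) = g x"
  shows "level_set g (x + gen i) = level_set g x"
proof (rule level_set_eq)
  show "x + gen i \<in> level_set g x"
    unfolding level_set_def
    by (rule graph_component_step[OF graph_component_self])
      (use assms nonconst_iff lattice_add_gen in \<open>auto simp: edge_rel_def\<close>)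
qed

lemma level_set_arc:
  assumes x: "x \<in> simplicial_lattice" and "a \<le> b" "b \<le> length is"
    and "\<And>k. a \<le> k \<Longrightarrow> k < b \<Longrightarrow> loop_step g x is k = 0"
  shows "level_set g (walk_end x (take b is)) = level_set g (walk_end x (take a is))"
  using assms(2-4)
proof (induction b rule: dec_induct)
  case (step b)
  have "g (walk_end x (take b is) + gen (is ! b)) = g (walk_end x (take b is))"
    using step.prems(2)[of b] step.hyps step.prems(1) by (simp add: loop_step_def walk_end_take_Suc)
  then have "level_set g (walk_end x (take (Suc b) is)) = level_set g (walk_end x (take b is))"
    using level_set_step[OF walk_end_lattice[OF x]] step.prems(1) by (simp add: walk_end_take_Suc)
  then show ?case
    using step by simp
qed simp

text \<open>The two nonconstant edges of a loop split it into two arcs on which \<open>g\<close> is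
  constant. One arc joins the lower ends of these edges, the other the upper ends.\<close>

lemma loop_adj_level_sets:
  assumes "(e, e') \<in> loop_adj" "e \<in> nonconst_edges g" "e' \<in> nonconst_edges g"
  shows "level_set g (lower_end g e) = level_set g (lower_end g e')"
    "level_set g (upper_end g e) = level_set g (upper_end g e')"
proof -
  obtain x "is" k l where xis: "x \<in> simplicial_lattice" "distinct is" "set is = UNIV"
    "k < CARD('n)" "l < CARD('n)" "e = loop_edge x is k" "e' = loop_edge x is l"
    using loop_adjE[OF assms(1)] .
  have len: "length is = CARD('n)"
    using xis length_loop by blast
  have nz: "loop_step g x is m \<noteq> 0" if "loop_edge x is m \<in> nonconst_edges g" for m
    using that by (auto simp: loop_step_def loop_edge_def nonconst_edges_def)
  have nzkl: "loop_step g x is k \<noteq> 0" "loop_step g x is l \<noteq> 0"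
    using nz assms xis by auto
  then obtain p q where pq: "p < CARD('n)" "q < CARD('n)" "p \<noteq> q"
    "loop_step g x is p = int CARD('n)" "loop_step g x is q = - int CARD('n)"
    "\<And>k. k < CARD('n) \<Longrightarrow> k \<noteq> p \<Longrightarrow> k \<noteq> q \<Longrightarrow> loop_step g x is k = 0"
    using loop[OF xis(1-3)] xis(4) by metis
  define P where "P m = walk_end x (take m is)" for m
  have arc: "level_set g (P a) = level_set g (P b)"
    if "a \<le> b" "b \<le> CARD('n)" "\<And>k. a \<le> k \<Longrightarrow> k < b \<Longrightarrow> k \<noteq> p \<and> k \<noteq> q" for a b
    unfolding P_def by (rule level_set_arc[symmetric]) (use that xis len pq(6) in auto)
  have wrap: "P (CARD('n)) = P 0"
    using walk_end_loop[OF xis(2,3)] len by (simp add: P_def)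
  have "g (P p) < g (P (Suc p))" "g (P (Suc q)) < g (P q)"
    using pq(4,5) card by (auto simp: loop_step_def P_def)
  then have ends: "lower_end g (loop_edge x is p) = P p" "upper_end g (loop_edge x is p) = P (Suc p)"
    "lower_end g (loop_edge x is q) = P (Suc q)" "upper_end g (loop_edge x is q) = P q"
    using lower_upper_end by (simp_all add: loop_edge_def P_def)
  \<comment> \<open>One of the two arcs runs through the base point and is put together from two
    pieces using \<open>P (CARD('n)) = P 0\<close>; the order of \<open>p\<close> and
    \<open>q\<close> decides which.\<close>
  have main: "level_set g (P p) = level_set g (P (Suc q)) \<and> level_set g (P (Suc p)) = level_set g (P q)"
  proof (cases "p < q")
    case True
    have "level_set g (P (Suc p)) = level_set g (P q)" "level_set g (P 0) = level_set g (P p)"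
      "level_set g (P (Suc q)) = level_set g (P (CARD('n)))"
      by (rule arc; use True pq(1,2) in force)+
    then show ?thesis
      using wrap by simp
  next
    case False
    have "level_set g (P (Suc q)) = level_set g (P p)" "level_set g (P 0) = level_set g (P q)"
      "level_set g (P (Suc p)) = level_set g (P (CARD('n)))"
      by (rule arc; use False pq(1-3) in force)+
    then show ?thesis
      using wrap by simp
  qed
  have "k \<in> {p, q}" "l \<in> {p, q}"
    using nzkl pq(6) xis(4,5) by auto
  then show "level_set g (lower_end g e) = level_set g (lower_end g e')"
    "level_set g (upper_end g e) = level_set g (upper_end g e')"
    using main ends xis(6,7) by auto
qed

lemma boundary_subset: "E \<in> boundaries g \<Longrightarrow> E \<subseteq> nonconst_edges g"
  using graph_component_subset[of _ "nonconst_edges g" loop_adj]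
  by (auto simp: boundaries_eq graph_components_def subset_iff)

lemma boundary_nonempty: "E \<in> boundaries g \<Longrightarrow> E \<noteq> {}"
  using graph_component_self by (fastforce simp: boundaries_eq graph_components_def)

lemma boundary_cover: "e \<in> nonconst_edges g \<Longrightarrow> \<exists>E\<in>boundaries g. e \<in> E"
  using graph_component_self by (fastforce simp: boundaries_eq graph_components_def)

lemma boundary_component:
  "E \<in> boundaries g \<Longrightarrow> e \<in> E \<Longrightarrow> E = graph_component (nonconst_edges g) loop_adj e"
  using graph_component_eq[OF sym_loop_adj] by (fastforce simp: boundaries_eq graph_components_def)

lemma boundary_disjoint:
  "\<lbrakk>E \<in> boundaries g; E' \<in> boundaries g; e \<in> E; e \<in> E'\<rbrakk> \<Longrightarrow> E = E'"
  using boundary_component by blast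

lemma boundary_adj:
  assumes "E \<in> boundaries g" "(e, e') \<in> loop_adj" "e \<in> nonconst_edges g" "e' \<in> nonconst_edges g"
  shows "e \<in> E \<longleftrightarrow> e' \<in> E"
proof -
  have "e' \<in> E" if "e \<in> E" "(e, e') \<in> loop_adj" "e \<in> nonconst_edges g" "e' \<in> nonconst_edges g" for e e'
    using boundary_component[OF assms(1) that(1)] graph_component_step[of e _ _ e] that
      graph_component_self by blast
  then show ?thesis
    using assms sym_loop_adj by (auto dest: symD)
qed

text \<open>This makes the two ends of a boundary well defined in the level set decomposition: edges
  on a common loop have the same end level sets, and a boundary is connected under that
  relation.\<close>

lemma boundary_level_sets:
  assumes "E \<in> boundaries g" "e \<in> E" "e' \<in> E"
  shows "level_set g (lower_end g e') = level_set g (lower_end g e)"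
    "level_set g (upper_end g e') = level_set g (upper_end g e)"
proof -
  have "e' \<in> graph_component (nonconst_edges g) loop_adj e"
    using assms boundary_component by blast
  then have "level_set g (lower_end g e') = level_set g (lower_end g e) \<and>
      level_set g (upper_end g e') = level_set g (upper_end g e)"
    by (induction rule: graph_component_induct) (auto simp: loop_adj_level_sets)
  then show "level_set g (lower_end g e') = level_set g (lower_end g e)"
    "level_set g (upper_end g e') = level_set g (upper_end g e)" by auto
qed

text \<open>The division is exact on the lattice, where \<open>step\<close> confines the increments
  of \<open>g\<close> to 0 and plus or minus \<open>CARD('n)\<close>.\<close>

definition crossing :: "(real ^ 'n) set set \<Rightarrow> real ^ 'n \<Rightarrow> 'n \<Rightarrow> int" where
  "crossing E x i = (if {x, x + gen i} \<in> E then (g (x + gen i) - g x) div int CARD('n) else 0)"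

text \<open>\<open>jump E\<close> is the potential \<open>h\<^sub>E\<close> of the introduction.\<close>

definition jump :: "(real ^ 'n) set set \<Rightarrow> real ^ 'n \<Rightarrow> int" where
  "jump E = potential (crossing E)"

text \<open>The two nonconstant edges of a loop are adjacent in the boundary graph, so
  \<open>E\<close> contains both or neither, and the contributions 1 and -1 cancel.\<close>

lemma closed_crossing:
  assumes E: "E \<in> boundaries g" shows "closed_form (crossing E)"
  unfolding closed_form_def
proof (intro ballI allI impI)
  fix x :: "real ^ 'n" and "is" :: "'n list" assume x: "x \<in> simplicial_lattice" and "distinct is \<and> set is = UNIV"
  then have "is": "distinct is" "set is = UNIV" by auto
  have len: "length is = CARD('n)"
    using "is" by (rule length_loop)
  have cr: "crossing E (walk_end x (take k is)) (is ! k) =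
      (if loop_edge x is k \<in> E then loop_step g x is k div int CARD('n) else 0)" if "k < CARD('n)" for k
    using that len by (simp add: crossing_def loop_edge_def loop_step_def walk_end_take_Suc)
  have nc: "loop_edge x is k \<in> nonconst_edges g \<longleftrightarrow> loop_step g x is k \<noteq> 0" if "k < CARD('n)" for k
    using that len nonconst_iff[OF walk_end_lattice[OF x]]
    by (simp add: loop_edge_def loop_step_def walk_end_take_Suc)
  have sum: "walk_sum (crossing E) x is =
      (\<Sum>k<CARD('n). if loop_edge x is k \<in> E then loop_step g x is k div int CARD('n) else 0)"
    unfolding walk_sum_conv_sum len by (intro sum.cong) (auto simp: cr)
  from loop[OF x "is"] show "walk_sum (crossing E) x is = 0"
  proof (elim disjE exE conjE)
    assume "\<forall>k<CARD('n). loop_step g x is k = 0"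
    then show ?thesis
      unfolding sum by (intro sum.neutral) auto
  next
    fix p q
    assume pq: "p < CARD('n)" "q < CARD('n)" "p \<noteq> q" "loop_step g x is p = int CARD('n)"
      "loop_step g x is q = - int CARD('n)"
      "\<forall>k<CARD('n). k \<noteq> p \<longrightarrow> k \<noteq> q \<longrightarrow> loop_step g x is k = 0"
    have "walk_sum (crossing E) x is =
      (\<Sum>k\<in>{p, q}. if loop_edge x is k \<in> E then loop_step g x is k div int CARD('n) else 0)"
      unfolding sum by (rule sum.mono_neutral_right) (use pq in auto)
    moreover have "loop_edge x is p \<in> E \<longleftrightarrow> loop_edge x is q \<in> E"
      by (rule boundary_adj[OF E loop_adjI[OF x "is"]]) (use pq nc in auto)
    ultimately show ?thesis
      using pq(3-5) by (simp add: uminus_card_div)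
  qed
qed

lemma jump_0: "E \<in> boundaries g \<Longrightarrow> jump E 0 = 0"
  unfolding jump_def by (rule potential_0[OF closed_crossing])

lemma jump_step:
  "E \<in> boundaries g \<Longrightarrow> x \<in> simplicial_lattice \<Longrightarrow> jump E (x + gen i) - jump E x = crossing E x i"
  unfolding jump_def using potential_step[OF closed_crossing] by simp

lemma jump_const:
  assumes "E \<in> boundaries g" "{a, b} \<in> lattice_edges" "{a, b} \<notin> E"
  shows "jump E a = jump E b"
proof -
  obtain x i where x: "x \<in> simplicial_lattice" "{a, b} = {x, x + gen i}"
    using assms(2) by (rule lattice_edgeE)
  have "jump E (x + gen i) = jump E x"
    using jump_step[OF assms(1) x(1), of i] assms(3) x(2) by (simp add: crossing_def)
  then show ?thesis
    using x(2) by (auto simp: doubleton_eq_iff)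
qed

lemma jump_cross:
  assumes "E \<in> boundaries g" "e \<in> E"
  shows "jump E (upper_end g e) = jump E (lower_end g e) + 1"
proof -
  have e: "e \<in> nonconst_edges g"
    using assms boundary_subset by blast
  then have "e \<in> lattice_edges"
    by (simp add: nonconst_edges_def)
  then obtain x i where x: "x \<in> simplicial_lattice" "e = {x, x + gen i}"
    by (rule lattice_edgeE)
  have cr: "jump E (x + gen i) - jump E x = (g (x + gen i) - g x) div int CARD('n)"
    using jump_step[OF assms(1) x(1), of i] assms(2) x(2) by (simp add: crossing_def)
  note ends = nonconst_ends[OF e]
  have "lower_end g e = x \<and> upper_end g e = x + gen i \<or> lower_end g e = x + gen i \<and> upper_end g e = x"
    using ends(1) x(2) by (metis doubleton_eq_iff)
  then show ?thesis
    using cr ends(4) by (auto simp: uminus_card_div)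
qed

lemma jump_level_set:
  assumes "E \<in> boundaries g" "level_set g u = level_set g v"
  shows "jump E u = jump E v"
proof -
  have "u \<in> level_set g v"
    using assms level_set_self by blast
  then show ?thesis
    unfolding level_set_def
  proof (induction rule: graph_component_induct)
    case (step y z)
    then have "{y, z} \<in> lattice_edges" "{y, z} \<notin> E"
      using boundary_subset[OF assms(1)] by (auto simp: edge_rel_def)
    then show ?case
      using jump_const[OF assms(1)] step by simp
  qed simp
qed

lemma jump_lower:
  assumes "E \<in> boundaries g" "e \<in> E" "e' \<in> E"
  shows "jump E (lower_end g e') = jump E (lower_end g e)"
  using jump_level_set boundary_level_sets assms by blast

text \<open>All lower ends of \<open>E\<close> lie in one level set, so every crossing of
  \<open>E\<close> is between the same two values \<open>a\<close> and \<open>a + 1\<close>.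
  Starting from 0, the potential can leave 0 only if 0 is one of them.\<close>

lemma jump_range:
  assumes E: "E \<in> boundaries g"
  shows "\<exists>\<sigma>\<in>{1, -1}. \<forall>u. jump E u \<in> {0, \<sigma>}"
proof -
  obtain e0 where e0: "e0 \<in> E"
    using boundary_nonempty[OF E] by blast
  define a where "a = jump E (lower_end g e0)"
  have inv: "jump E u = 0 \<or> (0 \<in> {a, a + 1} \<and> jump E u \<in> {a, a + 1})" if "u \<in> simplicial_lattice" for u
    using that
  proof (induction rule: lattice_induct)
    case zero
    show ?case using jump_0[OF E] by simp
  next
    case (step x i)
    show ?case
    proof (cases "{x, x + gen i} \<in> E")
      case False
      then show ?thesis
        using jump_const[OF E lattice_edgeI[OF step(1)]] step by auto
    next
      case True
      let ?e = "{x, x + gen i}"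
      have "{x, x + gen i} = {lower_end g ?e, upper_end g ?e}"
        using nonconst_ends(1) True boundary_subset[OF E] by blast
      moreover have "jump E (lower_end g ?e) = a" "jump E (upper_end g ?e) = a + 1"
        using jump_lower[OF E e0 True] jump_cross[OF E True] by (auto simp: a_def)
      ultimately have "jump E x = a \<and> jump E (x + gen i) = a + 1 \<or> jump E x = a + 1 \<and> jump E (x + gen i) = a"
        by (metis doubleton_eq_iff)
      then show ?thesis
        using step(2) by auto
    qed
  qed
  have "jump E u \<in> {0, if a = 0 then 1 else -1}" for u
  proof (cases "u \<in> simplicial_lattice")
    case True
    then show ?thesis using inv[of u] by auto
  next
    case False
    then show ?thesis by (simp add: jump_def potential_off)
  qed
  then show ?thesis
    by (intro bexI[of _ "if a = 0 then 1 else -1"]) auto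
qed

text \<open>The ends of the edges of \<open>E\<close> lie in just two level sets, and
  \<open>jump E\<close> tells these apart.\<close>

lemma boundary_same_side:
  assumes "E \<in> boundaries g" "e \<in> E" "e' \<in> E" "u \<in> e" "v \<in> e'" "jump E u = jump E v"
  shows "level_set g u = level_set g v"
proof -
  have "e = {lower_end g e, upper_end g e}" "e' = {lower_end g e', upper_end g e'}"
    using nonconst_ends(1) assms boundary_subset by blast+
  then have "u = lower_end g e \<or> u = upper_end g e" "v = lower_end g e' \<or> v = upper_end g e'"
    using assms(4,5) by blast+
  then show ?thesis
  proof (elim disjE)
    assume *: "u = lower_end g e" "v = upper_end g e'"
    show ?thesis
      using jump_lower[OF assms(1-3)] jump_cross[OF assms(1,3)] assms(6) unfolding * by linarith
  next
    assume *: "u = upper_end g e" "v = lower_end g e'"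
    show ?thesis
      using jump_lower[OF assms(1-3)] jump_cross[OF assms(1,2)] assms(6) unfolding * by linarith
  qed (simp_all only: boundary_level_sets[OF assms(1-3)])
qed

text \<open>The potential is constant on components once \<open>E\<close> is removed, which gives
  one direction. For the other, level sets stay connected without \<open>E\<close>, so all ends of
  \<open>E\<close> with potential 0 lie in one component; a walk that leaves potential 0 and returns
  to it comes back to the component of 0.\<close>

lemma separates_iff:
  assumes E: "E \<in> boundaries g" and x: "x \<in> simplicial_lattice"
  shows "separates_from_0 E x \<longleftrightarrow> jump E x \<noteq> 0"
proof -
  define C where "C = graph_component simplicial_lattice (edge_rel (lattice_edges - E))"
  have C_eq: "C v = C u" if "v \<in> C u" for u v
    unfolding C_def by (rule graph_component_eq[OF sym_edge_rel that[unfolded C_def]])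
  have C_step: "C (u + gen i) = C u" if "u \<in> simplicial_lattice" "{u, u + gen i} \<notin> E" for u i
    by (rule C_eq, unfold C_def, rule graph_component_step[OF graph_component_self])
      (use that lattice_add_gen in \<open>auto simp: edge_rel_def\<close>)
  have C_level: "C u = C v" if "level_set g u = level_set g v" for u v
  proof (rule C_eq)
    have "u \<in> level_set g v"
      using that level_set_self by blast
    then show "u \<in> C v"
      unfolding level_set_def
    proof (induction rule: graph_component_induct)
      case self
      show ?case by (simp add: C_def graph_component_self)
    next
      case (step y z)
      show ?case
        unfolding C_def by (rule graph_component_step[OF step(1)[unfolded C_def]])
          (use step in \<open>auto simp: edge_rel_def dest: subsetD[OF boundary_subset[OF E]]\<close>)
    qed
  qed
  \<comment> \<open>While the potential is nonzero, the invariant remembers that every edge of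
    \<open>E\<close> has an end with potential 0 in the component of 0. This identifies the point of
    return.\<close>
  have inv: "(jump E u = 0 \<longrightarrow> C u = C 0) \<and>
      (jump E u \<noteq> 0 \<longrightarrow> (\<forall>e\<in>E. \<exists>v\<in>e. jump E v = 0 \<and> C v = C 0))" if "u \<in> simplicial_lattice" for u
    using that
  proof (induction rule: lattice_induct)
    case zero
    show ?case using jump_0[OF E] by simp
  next
    case (step u i)
    show ?case
    proof (cases "{u, u + gen i} \<in> E")
      case False
      then show ?thesis
        using jump_const[OF E lattice_edgeI[OF step(1)]] step C_step by auto
    next
      case True
      let ?e = "{u, u + gen i}"
      have ends: "e = {lower_end g e, upper_end g e}" if "e \<in> E" for e
        using nonconst_ends(1) that boundary_subset[OF E] by blast
      have ne: "jump E u \<noteq> jump E (u + gen i)"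
      proof -
        have "lower_end g ?e = u \<and> upper_end g ?e = u + gen i \<or> lower_end g ?e = u + gen i \<and> upper_end g ?e = u"
          using ends[OF True] by (metis doubleton_eq_iff)
        then show ?thesis
          using jump_cross[OF E True] by auto
      qed
      show ?thesis
      proof (cases "jump E u = 0")
        case u0: True
        have "\<exists>v\<in>e. jump E v = 0 \<and> C v = C 0" if e: "e \<in> E" for e
        proof -
          obtain v where v: "v \<in> e" "jump E v = 0"
          proof -
            have "{jump E (lower_end g e), jump E (upper_end g e)} = {jump E u, jump E (u + gen i)}"
            proof -
              have "{jump E (lower_end g e), jump E (upper_end g e)} =
                  {jump E (lower_end g ?e), jump E (upper_end g ?e)}"
                using jump_cross[OF E True] jump_cross[OF E e] jump_lower[OF E True e] by simp
              also have "\<dots> = jump E ` ?e"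
                using arg_cong[OF ends[OF True], of "image (jump E)"] by simp
              finally show ?thesis by simp
            qed
            then have "0 \<in> {jump E (lower_end g e), jump E (upper_end g e)}"
              using u0 by auto
            then show thesis
              using that ends[OF e] by (metis empty_iff insert_iff)
          qed
          have "level_set g v = level_set g u"
            by (rule boundary_same_side[OF E e True v(1)]) (use u0 v(2) in auto)
          then have "C v = C 0"
            using C_level step(2) u0 by metis
          then show ?thesis
            using v by blast
        qed
        then show ?thesis
          using ne u0 by auto
      next
        case False
        then obtain v where v: "v \<in> ?e" "jump E v = 0" "C v = C 0"
          using step True by blast
        then have "v = u + gen i" using False by auto
        then show ?thesis using v by simp
      qed
    qed
  qed
  have "jump E x = 0" if "C x = C 0"
  proof -
    have "x \<in> C 0"
      using that graph_component_self by (metis C_def)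
    then have "jump E x = jump E 0"
      unfolding C_def
    proof (induction rule: graph_component_induct)
      case (step y z)
      then show ?case
        using jump_const[OF E, of y z] by (simp add: edge_rel_def)
    qed simp
    then show ?thesis using jump_0[OF E] by simp
  qed
  then have "C x = C 0 \<longleftrightarrow> jump E x = 0"
    using conjunct1[OF inv[OF x]] by (rule iffI[OF _ mp])
  then show ?thesis
    unfolding separates_from_0_def C_def[symmetric] by simp
qed

end


subsection \<open>The level set decomposition as a tree\<close>

context height_difference
begin

lemma level_setsD: "L \<in> level_sets g \<Longrightarrow> u \<in> L \<Longrightarrow> L = level_set g u"
  using level_set_eq by (auto simp: level_sets_def graph_components_def level_set_def[symmetric])

lemma level_setsI: "u \<in> simplicial_lattice \<Longrightarrow> level_set g u \<in> level_sets g"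
  by (auto simp: level_sets_def graph_components_def level_set_def)

lemma boundary_connects_iff:
  assumes "E \<in> boundaries g" "e \<in> E" "L \<in> level_sets g" "L' \<in> level_sets g"
  shows "boundary_connects g E L L' \<longleftrightarrow>
    L = level_set g (lower_end g e) \<and> L' = level_set g (upper_end g e)"
proof
  assume "boundary_connects g E L L'"
  then have "lower_end g e \<in> L" "upper_end g e \<in> L'"
    using assms(2) by (auto simp: boundary_connects_def)
  then show "L = level_set g (lower_end g e) \<and> L' = level_set g (upper_end g e)"
    using assms(3,4) level_setsD by blast
next
  assume *: "L = level_set g (lower_end g e) \<and> L' = level_set g (upper_end g e)"
  have "lower_end g e' \<in> L \<and> upper_end g e' \<in> L'" if "e' \<in> E" for e'
    using boundary_level_sets[OF assms(1,2) that] level_set_self * by metis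
  then show "boundary_connects g E L L'"
    by (auto simp: boundary_connects_def)
qed

lemma LSD_edgeE:
  assumes "(L, L') \<in> LSD g"
  obtains E e where "E \<in> boundaries g" "e \<in> E"
    "L = level_set g (lower_end g e) \<and> L' = level_set g (upper_end g e) \<or>
     L = level_set g (upper_end g e) \<and> L' = level_set g (lower_end g e)"
proof -
  obtain E where E: "E \<in> boundaries g" "L \<in> level_sets g" "L' \<in> level_sets g"
    "boundary_connects g E L L' \<or> boundary_connects g E L' L"
    using assms by (auto simp: LSD_def)
  obtain e where e: "e \<in> E"
    using boundary_nonempty[OF E(1)] by blast
  then show ?thesis
    using that[OF E(1) e] E(4) boundary_connects_iff[OF E(1) e] E(2,3) by blast
qed

lemma LSD_edgeI:
  assumes "e \<in> nonconst_edges g"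
  shows "(level_set g (lower_end g e), level_set g (upper_end g e)) \<in> LSD g"
proof -
  obtain E where E: "E \<in> boundaries g" "e \<in> E"
    using boundary_cover[OF assms] by blast
  have "level_set g (lower_end g e) \<in> level_sets g" "level_set g (upper_end g e) \<in> level_sets g"
    using nonconst_ends[OF assms] level_setsI by auto
  then show ?thesis
    using boundary_connects_iff[OF E] E(1) by (auto simp: LSD_def)
qed

lemma sym_LSD: "sym (LSD g)"
  by (auto simp: sym_def LSD_def)

lemma LSD_connected:
  assumes "u \<in> simplicial_lattice"
  shows "(level_set g 0, level_set g u) \<in> (LSD g)\<^sup>*"
  using assms
proof (induction rule: lattice_induct)
  case (step x i)
  have "(level_set g x, level_set g (x + gen i)) \<in> (LSD g)\<^sup>="
  proof (cases "g (x + gen i) = g x")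
    case True
    then show ?thesis
      using level_set_step[OF step(1)] by simp
  next
    case False
    let ?e = "{x, x + gen i}"
    have e: "?e \<in> nonconst_edges g"
      using False step(1) nonconst_iff by simp
    have "lower_end g ?e = x \<and> upper_end g ?e = x + gen i \<or> lower_end g ?e = x + gen i \<and> upper_end g ?e = x"
      using nonconst_ends(1)[OF e] by (metis doubleton_eq_iff)
    then show ?thesis
      using LSD_edgeI[OF e] sym_LSD by (auto dest: symD)
  qed
  then show ?case
    using step(2) by (auto intro: rtrancl_into_rtrancl)
qed simp

text \<open>For a boundary \<open>E\<close> the potential is constant on each level set, so one
  witness speaks for all of \<open>L\<close>; the quantifier avoids the choice of a
  representative.\<close>

definition beyond :: "(real ^ 'n) set set \<Rightarrow> (real ^ 'n) set \<Rightarrow> bool" where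
  "beyond E L \<longleftrightarrow> (\<exists>u\<in>L. jump E u \<noteq> 0)"

lemma beyond_level_set:
  assumes "E \<in> boundaries g" shows "beyond E (level_set g u) \<longleftrightarrow> jump E u \<noteq> 0"
  using jump_level_set[OF assms] level_set_eq level_set_self unfolding beyond_def by metis

text \<open>Crossing \<open>E\<close> changes its potential by 1 inside
  \<open>{0, \<sigma>}\<close>, so exactly one end has value 0. Boundaries are disjoint, so an edge
  of \<open>E\<close> crosses no other boundary.\<close>

lemma beyond_flip:
  assumes "E \<in> boundaries g" "E' \<in> boundaries g" "e \<in> E"
  shows "beyond E' (level_set g (lower_end g e)) \<noteq> beyond E' (level_set g (upper_end g e)) \<longleftrightarrow> E' = E"
proof (cases "E' = E")
  case True
  obtain \<sigma> where "\<sigma> \<in> {1, -1}" "\<forall>u. jump E u \<in> {0, \<sigma>}"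
    using jump_range[OF assms(1)] by blast
  then have "jump E (lower_end g e) \<in> {0, \<sigma>}" "jump E (upper_end g e) \<in> {0, \<sigma>}" "\<sigma> \<in> {1, -1}"
    by blast+
  then have "jump E (lower_end g e) \<noteq> 0 \<longleftrightarrow> jump E (upper_end g e) = 0"
    using jump_cross[OF assms(1,3)] by force
  then show ?thesis
    using True beyond_level_set[OF assms(1)] by simp
next
  case False
  have e: "e \<in> nonconst_edges g"
    using assms boundary_subset by blast
  have "e \<in> lattice_edges" "e \<notin> E'"
    using e boundary_disjoint[OF assms(1,2,3)] False by (auto simp: nonconst_edges_def)
  then have "jump E' (lower_end g e) = jump E' (upper_end g e)"
    by (intro jump_const[OF assms(2)]) (simp_all only: nonconst_ends(1)[OF e, symmetric] not_False_eq_True)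
  then show ?thesis
    using False beyond_level_set[OF assms(2)] by simp
qed

text \<open>Each boundary serves as a cut. An edge of \<open>LSD g\<close> that flips
  \<open>beyond E\<close> must come from \<open>E\<close> itself, and all edges of \<open>E\<close>
  join the same two level sets, which yields uniqueness.\<close>

sublocale LSD: cut_graph "level_sets g" "LSD g" beyond "boundaries g"
proof
  show "sym (LSD g)" by (rule sym_LSD)
  show "LSD g \<subseteq> level_sets g \<times> level_sets g"
    by (auto simp: LSD_def)
  show "\<exists>E\<in>boundaries g. \<forall>E'\<in>boundaries g. beyond E' L \<noteq> beyond E' L' \<longleftrightarrow> E' = E"
    if LL: "(L, L') \<in> LSD g" for L L'
  proof -
    obtain E e where E: "E \<in> boundaries g" "e \<in> E"
      "L = level_set g (lower_end g e) \<and> L' = level_set g (upper_end g e) \<or>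
       L = level_set g (upper_end g e) \<and> L' = level_set g (lower_end g e)"
      by (rule LSD_edgeE[OF LL])
    show ?thesis
    proof (intro bexI[OF _ E(1)] ballI)
      fix E' assume "E' \<in> boundaries g"
      from beyond_flip[OF E(1) this E(2)] show "beyond E' L \<noteq> beyond E' L' \<longleftrightarrow> E' = E"
        using E(3) by metis
    qed
  qed
  show "L = M \<and> L' = M'"
    if LL: "(L, L') \<in> LSD g" "(M, M') \<in> LSD g" and E: "E \<in> boundaries g"
      and flip: "beyond E L \<noteq> beyond E L'" "beyond E M \<noteq> beyond E M'" "beyond E L = beyond E M"
    for L L' M M' E
  proof -
    obtain E1 e1 where E1: "E1 \<in> boundaries g" "e1 \<in> E1"
      "L = level_set g (lower_end g e1) \<and> L' = level_set g (upper_end g e1) \<or>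
       L = level_set g (upper_end g e1) \<and> L' = level_set g (lower_end g e1)"
      by (rule LSD_edgeE[OF LL(1)])
    obtain E2 e2 where E2: "E2 \<in> boundaries g" "e2 \<in> E2"
      "M = level_set g (lower_end g e2) \<and> M' = level_set g (upper_end g e2) \<or>
       M = level_set g (upper_end g e2) \<and> M' = level_set g (lower_end g e2)"
      by (rule LSD_edgeE[OF LL(2)])
    have "E = E1" "E = E2"
      using beyond_flip[OF E1(1) E E1(2)] beyond_flip[OF E2(1) E E2(2)] E1(3) E2(3) flip by metis+
    then have "e1 \<in> E" "e2 \<in> E"
      using E1(2) E2(2) by simp_all
    note same = boundary_level_sets[OF E this]
    then show ?thesis
      using E1(3) E2(3) flip same by metis
  qed
  show "(L, L') \<in> (LSD g)\<^sup>*" if "L \<in> level_sets g" "L' \<in> level_sets g" for L L'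
  proof -
    have "(level_set g 0, M) \<in> (LSD g)\<^sup>*" if "M \<in> level_sets g" for M
      using that LSD_connected by (auto simp: level_sets_def graph_components_def level_set_def[symmetric])
    then show ?thesis
      using that sym_rtrancl[OF sym_LSD] by (meson rtrancl_trans symD)
  qed
qed

lemma LSD_sep:
  "LSD.sep (level_set g 0) (level_set g u) = {E \<in> boundaries g. jump E u \<noteq> 0}"
  using beyond_level_set jump_0 by (auto simp: LSD.sep_def)

text \<open>By \<open>last_common_sep\<close>, the boundaries between 0 and the last common vertex
  are those separating 0 from both points, and tree distance counts them.\<close>

lemma graph_dist_last_common_vertex:
  assumes "x \<in> simplicial_lattice" "y \<in> simplicial_lattice"
  shows "graph_dist (LSD g) (level_set g 0) (last_common_vertex g x y) =
    card {E \<in> boundaries g. separates_from_0 E x \<and> separates_from_0 E y}"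
proof -
  note V = level_setsI[OF lattice_0] level_setsI[OF assms(1)] level_setsI[OF assms(2)]
  note z = LSD.last_common_sep[OF V, folded last_common_vertex_def]
  have "graph_dist (LSD g) (level_set g 0) (last_common_vertex g x y) =
      card ({E \<in> boundaries g. jump E x \<noteq> 0} \<inter> {E \<in> boundaries g. jump E y \<noteq> 0})"
    using LSD.graph_dist_eq[OF V(1) z(1)] z(2) by (simp add: LSD_sep)
  also have "{E \<in> boundaries g. jump E x \<noteq> 0} \<inter> {E \<in> boundaries g. jump E y \<noteq> 0} =
      {E \<in> boundaries g. separates_from_0 E x \<and> separates_from_0 E y}"
    using separates_iff assms by auto
  finally show ?thesis .
qed

section \<open>Decomposition of a height difference over its boundaries\<close>

lemma finite_boundaries: "finite (nonconst_edges g) \<Longrightarrow> finite (boundaries g)"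
  by (simp add: boundaries_eq graph_components_def)

text \<open>Both sides vanish at 0 and have the same steps, because a nonconstant edge lies in
  exactly one boundary.\<close>

lemma g_eq_sum_jump:
  assumes fin: "finite (nonconst_edges g)" and "g 0 = 0" and x: "x \<in> simplicial_lattice"
  shows "g x = int CARD('n) * (\<Sum>E\<in>boundaries g. jump E x)"
  using x
proof (rule lattice_fun_eqI)
  show "g 0 = int CARD('n) * (\<Sum>E\<in>boundaries g. jump E 0)"
    using assms(2) jump_0 by simp
  fix x i assume x: "x \<in> (simplicial_lattice :: (real ^ 'n) set)"
  let ?e = "{x, x + gen i}"
  have "(\<Sum>E\<in>boundaries g. jump E (x + gen i)) - (\<Sum>E\<in>boundaries g. jump E x) =
      (\<Sum>E\<in>boundaries g. crossing E x i)"
    using jump_step[OF _ x] by (simp add: sum_subtractf[symmetric])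
  moreover have "int CARD('n) * (\<Sum>E\<in>boundaries g. crossing E x i) = g (x + gen i) - g x"
  proof (cases "?e \<in> nonconst_edges g")
    case True
    then obtain E where E: "E \<in> boundaries g" "?e \<in> E"
      using boundary_cover by blast
    then have "(\<Sum>E\<in>boundaries g. crossing E x i) = (\<Sum>E'\<in>{E}. crossing E' x i)"
      using boundary_disjoint
      by (intro sum.mono_neutral_right finite_boundaries fin) (auto simp: crossing_def)
    then show ?thesis
      using E step[OF x, of i] by (auto simp: crossing_def uminus_card_div)
  next
    case False
    then have "crossing E x i = 0" if "E \<in> boundaries g" for E
      using boundary_subset[OF that] by (auto simp: crossing_def)
    then show ?thesis
      using False nonconst_iff[OF x] by simp
  qed
  ultimately show "g (x + gen i) - g x = int CARD('n) * (\<Sum>E\<in>boundaries g. jump E (x + gen i)) -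
      int CARD('n) * (\<Sum>E\<in>boundaries g. jump E x)"
    by (simp add: right_diff_distrib[symmetric])
qed

end


subsection \<open>Covariances and the swapping involution\<close>

lemma measure_pmf_expectation_pair:
  fixes F :: "'a \<times> 'a \<Rightarrow> real"
  assumes "finite S" "set_pmf p \<subseteq> S"
  shows "measure_pmf.expectation (pair_pmf p p) F = (\<Sum>a\<in>S. \<Sum>b\<in>S. F (a, b) * (pmf p a * pmf p b))"
proof -
  have "measure_pmf.expectation (pair_pmf p p) F = (\<Sum>q\<in>S \<times> S. F q * pmf (pair_pmf p p) q)"
    by (rule integral_measure_pmf_real) (use assms in auto)
  also have "\<dots> = (\<Sum>a\<in>S. \<Sum>b\<in>S. F (a, b) * (pmf p a * pmf p b))"
    unfolding sum.cartesian_product by (intro sum.cong refl) (auto simp: pmf_pair)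
  finally show ?thesis .
qed

text \<open>After centring, the mixed terms of the expanded product factor by independence and
  vanish; each of the two remaining terms contributes the covariance.\<close>

lemma covariance_pair_pmf:
  fixes A B :: "'a \<Rightarrow> real"
  assumes S: "finite S" "set_pmf p \<subseteq> S"
  shows "covariance (pair_pmf p p) (\<lambda>(a, b). A a) (\<lambda>(a, b). B a) =
    1/2 * measure_pmf.expectation (pair_pmf p p) (\<lambda>(a, b). (A a - A b) * (B a - B b))"
proof -
  note E = measure_pmf_expectation_pair[OF S]
  have one: "(\<Sum>a\<in>S. pmf p a) = 1"
    using sum_pmf_eq_1[OF S] .
  define \<mu> where "\<mu> = (\<Sum>a\<in>S. A a * pmf p a)"
  define \<nu> where "\<nu> = (\<Sum>a\<in>S. B a * pmf p a)"
  define \<alpha> where "\<alpha> a = A a - \<mu>" for a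
  define \<beta> where "\<beta> a = B a - \<nu>" for a
  define C where "C = (\<Sum>a\<in>S. \<alpha> a * \<beta> a * pmf p a)"
  have marginal: "(\<Sum>a\<in>S. \<Sum>b\<in>S. G a * (pmf p a * pmf p b)) = (\<Sum>a\<in>S. G a * pmf p a)" for G
    using one by (simp add: mult.assoc[symmetric] sum_distrib_left[symmetric])
  have marginal': "(\<Sum>a\<in>S. \<Sum>b\<in>S. G b * (pmf p a * pmf p b)) = (\<Sum>a\<in>S. G a * pmf p a)" for G
    by (subst sum.swap) (use marginal[of G] in \<open>simp add: mult.commute\<close>)
  have means: "measure_pmf.expectation (pair_pmf p p) (\<lambda>(a, b). A a) = \<mu>"
    "measure_pmf.expectation (pair_pmf p p) (\<lambda>(a, b). B a) = \<nu>"
    using marginal[of A] marginal[of B] by (simp_all add: E \<mu>_def \<nu>_def)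
  have zero: "(\<Sum>a\<in>S. \<alpha> a * pmf p a) = 0"
    using one by (simp add: \<alpha>_def left_diff_distrib sum_subtractf \<mu>_def[symmetric] sum_distrib_left[symmetric])
  have cross: "(\<Sum>a\<in>S. \<Sum>b\<in>S. (\<alpha> a * \<beta> b) * (pmf p a * pmf p b)) = 0"
  proof -
    have "(\<Sum>a\<in>S. \<Sum>b\<in>S. (\<alpha> a * \<beta> b) * (pmf p a * pmf p b)) =
        (\<Sum>a\<in>S. \<alpha> a * pmf p a) * (\<Sum>b\<in>S. \<beta> b * pmf p b)"
      by (simp add: sum_product mult_ac)
    then show ?thesis using zero by simp
  qed
  have cross': "(\<Sum>a\<in>S. \<Sum>b\<in>S. (\<alpha> b * \<beta> a) * (pmf p a * pmf p b)) = 0"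
    by (subst sum.swap) (use cross in \<open>simp add: mult_ac\<close>)
  have "covariance (pair_pmf p p) (\<lambda>(a, b). A a) (\<lambda>(a, b). B a) =
      (\<Sum>a\<in>S. \<Sum>b\<in>S. (\<alpha> a * \<beta> a) * (pmf p a * pmf p b))"
    unfolding covariance_def means unfolding E by (simp add: \<alpha>_def \<beta>_def)
  then have cov: "covariance (pair_pmf p p) (\<lambda>(a, b). A a) (\<lambda>(a, b). B a) = C"
    using marginal[of "\<lambda>a. \<alpha> a * \<beta> a"] by (simp add: C_def)
  have "measure_pmf.expectation (pair_pmf p p) (\<lambda>(a, b). (A a - A b) * (B a - B b)) =
      (\<Sum>a\<in>S. \<Sum>b\<in>S. (\<alpha> a * \<beta> a) * (pmf p a * pmf p b) + (\<alpha> b * \<beta> b) * (pmf p a * pmf p b)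
        - (\<alpha> a * \<beta> b) * (pmf p a * pmf p b) - (\<alpha> b * \<beta> a) * (pmf p a * pmf p b))"
    unfolding E by (intro sum.cong refl) (simp add: \<alpha>_def \<beta>_def algebra_simps)
  also have "\<dots> = C + C - 0 - 0"
    using marginal[of "\<lambda>a. \<alpha> a * \<beta> a"] marginal'[of "\<lambda>a. \<alpha> a * \<beta> a"] cross cross'
    by (simp add: sum.distrib sum_subtractf C_def)
  finally show ?thesis
    using cov by simp
qed

section \<open>Height functions on simplicial loops\<close>

lemma height_function_step:
  "f \<in> height_functions \<Longrightarrow> x \<in> simplicial_lattice \<Longrightarrow>
    f (x + gen i) - f x \<in> {1, 1 - int CARD('n::finite)}" for f :: "real ^ 'n \<Rightarrow> int"
  by (simp add: height_functions_def)

text \<open>The steps around a loop sum to 0. There are \<open>CARD('n)\<close> of them, each equal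
  to 1 or, at a drop, smaller by \<open>CARD('n)\<close>, which forces exactly one drop.\<close>

lemma height_function_loop:
  fixes f :: "real ^ 'n \<Rightarrow> int"
  assumes f: "f \<in> height_functions" and x: "x \<in> simplicial_lattice"
    and "is": "distinct is" "set is = UNIV"
  shows "\<exists>p<CARD('n). \<forall>k<CARD('n). loop_step f x is k = (if k = p then 1 - int CARD('n) else 1)"
proof -
  have len: "length is = CARD('n)"
    using "is" by (rule length_loop)
  define A where "A = {k. k < CARD('n) \<and> loop_step f x is k = 1 - int CARD('n)}"
  have st: "loop_step f x is k = 1 - (if k \<in> A then int CARD('n) else 0)" if "k < CARD('n)" for k
    using height_function_step[OF f walk_end_lattice[OF x], of "take k is" "is ! k"] that len
    by (auto simp: A_def loop_step_def walk_end_take_Suc)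
  have "(\<Sum>k<CARD('n). loop_step f x is k) = 0"
    using walk_end_loop[OF "is", of x] len sum_lessThan_telescope[of "\<lambda>k. f (walk_end x (take k is))" "CARD('n)"]
    by (simp add: loop_step_def)
  also have "(\<Sum>k<CARD('n). loop_step f x is k) =
      (\<Sum>k<CARD('n). 1 - (if k \<in> A then int CARD('n) else 0))"
    by (intro sum.cong) (auto simp: st)
  also have "\<dots> = int CARD('n) - int CARD('n) * int (card A)"
  proof -
    have "{..<CARD('n)} \<inter> A = A" by (auto simp: A_def)
    then show ?thesis
      by (simp add: sum_subtractf sum.If_cases)
  qed
  finally have "card A = 1" by simp
  then obtain p where "A = {p}"
    by (auto simp: card_1_singleton_iff)
  then show ?thesis
    by (intro exI[of _ p]) (auto simp: st A_def)
qed

lemma height_difference_heights: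
  fixes f1 f2 :: "real ^ 'n \<Rightarrow> int"
  assumes "CARD('n) \<ge> 3" "f1 \<in> height_functions" "f2 \<in> height_functions"
  shows "height_difference (\<lambda>u. f1 u - f2 u)"
proof
  fix x :: "real ^ 'n" and "is" :: "'n list"
  assume x: "x \<in> simplicial_lattice" "distinct is" "set is = UNIV"
  have D: "loop_step (\<lambda>u. f1 u - f2 u) x is k = loop_step f1 x is k - loop_step f2 x is k" for k
    by (simp add: loop_step_def)
  obtain p where p: "p < CARD('n)" "\<forall>k<CARD('n). loop_step f1 x is k = (if k = p then 1 - int CARD('n) else 1)"
    using height_function_loop[OF assms(2) x] by blast
  obtain q where q: "q < CARD('n)" "\<forall>k<CARD('n). loop_step f2 x is k = (if k = q then 1 - int CARD('n) else 1)"
    using height_function_loop[OF assms(3) x] by blast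
  show "(\<forall>k<CARD('n). loop_step (\<lambda>u. f1 u - f2 u) x is k = 0) \<or>
      (\<exists>p q. p < CARD('n) \<and> q < CARD('n) \<and> p \<noteq> q \<and>
         loop_step (\<lambda>u. f1 u - f2 u) x is p = int CARD('n) \<and>
         loop_step (\<lambda>u. f1 u - f2 u) x is q = - int CARD('n) \<and>
         (\<forall>k<CARD('n). k \<noteq> p \<longrightarrow> k \<noteq> q \<longrightarrow> loop_step (\<lambda>u. f1 u - f2 u) x is k = 0))"
  proof (cases "p = q")
    case True
    then show ?thesis using p q by (simp add: D)
  next
    case False
    \<comment> \<open>The difference rises where \<open>f2\<close> drops and falls where
      \<open>f1\<close> drops, so the witnesses are \<open>q\<close> for the positive and
      \<open>p\<close> for the negative step.\<close>
    then show ?thesis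
      using p q by (intro disjI2 exI[of _ q] exI[of _ p]) (simp add: D)
  qed
qed (rule assms)

section \<open>Reflection of a difference across a boundary\<close>

context height_difference
begin

lemma card_mult_crossing:
  assumes "x \<in> simplicial_lattice"
  shows "int CARD('n) * crossing E x i = (if {x, x + gen i} \<in> E then g (x + gen i) - g x else 0)"
  using step[OF assms, of i] by (auto simp: crossing_def uminus_card_div)

lemma card_mult_jump_step:
  assumes "E \<in> boundaries g" "x \<in> simplicial_lattice"
  shows "int CARD('n) * jump E (x + gen i) = int CARD('n) * jump E x +
    (if {x, x + gen i} \<in> E then g (x + gen i) - g x else 0)"
proof -
  have "jump E (x + gen i) = jump E x + crossing E x i"
    using jump_step[OF assms, of i] by simp
  then show ?thesis
    using card_mult_crossing[OF assms(2), of E i] by (simp add: distrib_left)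
qed

text \<open>Removing the contribution of \<open>E\<close> twice reverses the steps of
  \<open>g\<close> on \<open>E\<close> and keeps all others. By \<open>swap_diff\<close> this is the
  difference of two height functions after their exchange along \<open>E\<close>.\<close>

definition reflect :: "(real ^ 'n) set set \<Rightarrow> real ^ 'n \<Rightarrow> int" where
  "reflect E u = g u - 2 * (int CARD('n) * jump E u)"

lemma reflect_step:
  assumes "E \<in> boundaries g" "x \<in> simplicial_lattice"
  shows "reflect E (x + gen i) - reflect E x =
    (if {x, x + gen i} \<in> E then - (g (x + gen i) - g x) else g (x + gen i) - g x)"
  using card_mult_jump_step[OF assms, of i] by (simp add: reflect_def)

lemma nonconst_edges_reflect:
  assumes "E \<in> boundaries g"
  shows "nonconst_edges (reflect E) = nonconst_edges g"
proof -
  have "e \<in> nonconst_edges (reflect E) \<longleftrightarrow> e \<in> nonconst_edges g" if "e \<in> lattice_edges" for e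
  proof -
    obtain x i where x: "x \<in> simplicial_lattice" "e = {x, x + gen i}"
      using \<open>e \<in> lattice_edges\<close> by (rule lattice_edgeE)
    have "reflect E (x + gen i) - reflect E x = 0 \<longleftrightarrow> g (x + gen i) - g x = 0"
      unfolding reflect_step[OF assms x(1)] by auto
    then show ?thesis
      using that x by (auto simp: nonconst_edges_def)
  qed
  moreover have "nonconst_edges h \<subseteq> lattice_edges" for h :: "real ^ 'n \<Rightarrow> int"
    by (auto simp: nonconst_edges_def)
  ultimately show ?thesis
    by blast
qed

text \<open>Boundaries depend on a function only through its set of nonconstant edges.\<close>

lemma boundaries_reflect: "E \<in> boundaries g \<Longrightarrow> boundaries (reflect E) = boundaries g"
  by (simp add: boundaries_eq nonconst_edges_reflect)

text \<open>A potential is determined by its steps, and reflection reverses only those on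
  \<open>E\<close>. The assumption \<open>hd\<close> is supplied by
  \<open>height_difference_swap\<close>.\<close>

lemma jump_reflect:
  assumes hd: "height_difference (reflect E)" and E: "E \<in> boundaries g" and E': "E' \<in> boundaries g"
  shows "height_difference.jump (reflect E) E' u = (if E' = E then - jump E' u else jump E' u)"
proof (cases "u \<in> simplicial_lattice")
  case True
  interpret r: height_difference "reflect E" by (rule hd)
  have rE': "E' \<in> boundaries (reflect E)"
    using E' boundaries_reflect[OF E] by simp
  have cr: "r.crossing E' x i = (if E' = E then - crossing E' x i else crossing E' x i)"
    if x: "x \<in> simplicial_lattice" for x i
  proof -
    have "int CARD('n) * r.crossing E' x i = int CARD('n) * (if E' = E then - crossing E' x i else crossing E' x i)"
      using r.card_mult_crossing[OF x, of E' i] card_mult_crossing[OF x, of E' i]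
        reflect_step[OF E x, of i] boundary_disjoint[OF E E'] by auto
    then show ?thesis
      unfolding mult_cancel_left by simp
  qed
  from True show ?thesis
  proof (rule lattice_fun_eqI)
    show "r.jump E' 0 = (if E' = E then - jump E' 0 else jump E' 0)"
      using jump_0[OF E'] jump_0[OF E] r.jump_0[OF rE'] by simp
    fix x i assume x: "x \<in> (simplicial_lattice :: (real ^ 'n) set)"
    show "r.jump E' (x + gen i) - r.jump E' x =
        (if E' = E then - jump E' (x + gen i) else jump E' (x + gen i)) - (if E' = E then - jump E' x else jump E' x)"
      unfolding r.jump_step[OF rE' x] cr[OF x] using jump_step[OF E' x, of i] jump_step[OF E x, of i] by simp
  qed
next
  case False
  then show ?thesis
    using height_difference.jump_def[OF hd] by (simp add: jump_def potential_off)
qed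

end

section \<open>Exchange of two height functions along a boundary\<close>

abbreviation height_jump :: "(real ^ 'n \<Rightarrow> int) \<Rightarrow> (real ^ 'n \<Rightarrow> int) \<Rightarrow> (real ^ 'n) set set \<Rightarrow> real ^ 'n \<Rightarrow> int" where
  "height_jump f1 f2 \<equiv> height_difference.jump (\<lambda>u. f1 u - f2 u)"

text \<open>For a boundary \<open>E\<close>, the function
  \<open>int CARD('n) * height_jump f1 f2 E u\<close> of \<open>u\<close> has the steps of
  \<open>f1 - f2\<close> on \<open>E\<close> and is constant along all other edges, so the two
  formulas exchange the steps of \<open>f1\<close> and \<open>f2\<close> exactly on
  \<open>E\<close>.\<close>

definition swap_heights ::
    "(real ^ 'n) set set \<Rightarrow> (real ^ 'n \<Rightarrow> int) \<times> (real ^ 'n \<Rightarrow> int) \<Rightarrow> (real ^ 'n \<Rightarrow> int) \<times> (real ^ 'n \<Rightarrow> int)" where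
  "swap_heights E = (\<lambda>(f1, f2).
     (\<lambda>u. f1 u - int CARD('n) * height_jump f1 f2 E u, \<lambda>u. f2 u + int CARD('n) * height_jump f1 f2 E u))"

lemma down_edges_iff:
  fixes f :: "real ^ 'n \<Rightarrow> int"
  assumes "CARD('n) \<ge> 3" "x \<in> simplicial_lattice"
  shows "{x, x + gen i} \<in> down_edges f \<longleftrightarrow> f (x + gen i) - f x = 1 - int CARD('n)"
  using assms by (auto simp: down_edges_def lattice_edge_eq_iff)

lemma finite_edges_at:
  fixes R :: "(real ^ 'n) set"
  assumes "finite R" shows "finite (edges_at R)"
proof -
  have "edges_at R \<subseteq> (\<lambda>(x, i). {x, x + gen i}) ` (R \<times> UNIV) \<union> (\<lambda>(x, i). {x - gen i, x}) ` (R \<times> UNIV)"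
  proof
    fix e :: "(real ^ 'n) set" assume e: "e \<in> edges_at R"
    then obtain x i where x: "e = {x, x + gen i}" "x \<in> R \<or> x + gen i \<in> R"
      by (auto simp: edges_at_def lattice_edges_def)
    from x(2) show "e \<in> (\<lambda>(x, i). {x, x + gen i}) ` (R \<times> UNIV) \<union> (\<lambda>(x, i). {x - gen i, x}) ` (R \<times> UNIV)"
    proof
      assume "x \<in> R"
      then show ?thesis using x(1) by force
    next
      assume "x + gen i \<in> R"
      then have "e \<in> (\<lambda>(x, i). {x - gen i, x}) ` (R \<times> UNIV)"
        using x(1) by (intro image_eqI[of _ _ "(x + gen i, i)"]) auto
      then show ?thesis by blast
    qed
  qed
  then show ?thesis
    by (rule finite_subset) (use assms in auto)
qed

text \<open>A product over an index set independent of \<open>f\<close> allows the weights of two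
  functions to be multiplied edge by edge.\<close>

lemma boltzmann_weight_eq:
  assumes "finite R"
  shows "boltzmann_weight R w f = (\<Prod>e\<in>edges_at R. if e \<in> down_edges f then w e else 1)"
  unfolding boltzmann_weight_def
  using finite_edges_at[OF assms] by (simp add: prod.inter_restrict[symmetric] Int_commute)

locale height_pair =
  fixes f1 f2 b :: "real ^ 'n \<Rightarrow> int" and R :: "(real ^ 'n) set"
  assumes card3: "CARD('n) \<ge> 3" and R: "region R" "0 \<notin> R"
    and f1: "f1 \<in> height_functions_on R b" and f2: "f2 \<in> height_functions_on R b"
begin

lemma heights: "f1 \<in> height_functions" "f2 \<in> height_functions"
  using f1 f2 by (auto simp: height_functions_on_def)

sublocale height_difference "\<lambda>u. f1 u - f2 u"
  by (rule height_difference_heights[OF card3 heights])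

abbreviation "diff \<equiv> \<lambda>u. f1 u - f2 u"

lemma eq_off: "x \<in> simplicial_lattice - R \<Longrightarrow> f1 x = f2 x"
  using f1 f2 by (simp add: height_functions_on_def)

lemma eq_0: "f1 0 = f2 0"
  using eq_off[of 0] R(2) by simp

lemma nonconst_subset: "nonconst_edges diff \<subseteq> edges_at R"
proof
  fix e assume e: "e \<in> nonconst_edges diff"
  then have "e \<in> lattice_edges"
    by (simp add: nonconst_edges_def)
  moreover from this obtain x i where x: "x \<in> simplicial_lattice" "e = {x, x + gen i}"
    by (rule lattice_edgeE)
  moreover have "x \<in> R \<or> x + gen i \<in> R"
  proof (rule ccontr)
    assume "\<not> (x \<in> R \<or> x + gen i \<in> R)"
    then have "f1 x = f2 x" "f1 (x + gen i) = f2 (x + gen i)"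
      using eq_off[of x] eq_off[of "x + gen i"] x(1) lattice_add_gen[OF x(1)] by simp_all
    then show False
      using e x by (simp add: nonconst_iff)
  qed
  ultimately show "e \<in> edges_at R"
    using x(2) by (auto simp: edges_at_def)
qed

lemma finite_nonconst: "finite (nonconst_edges diff)"
  using nonconst_subset finite_edges_at R(1) finite_subset by (auto simp: region_def)

text \<open>The complement of \<open>R\<close> is connected and contains 0, and every edge of
  \<open>E\<close> meets \<open>R\<close>, so the potential keeps the value 0 there. This makes the
  exchange respect the boundary condition \<open>b\<close>.\<close>

lemma jump_off_region:
  assumes "E \<in> boundaries diff" "x \<in> simplicial_lattice - R" shows "jump E x = 0"
proof -
  have "x \<in> graph_component (simplicial_lattice - R) (edge_rel lattice_edges) 0"
    using R assms(2) by (simp add: region_def graph_connected_def)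
  then show ?thesis
  proof (induction rule: graph_component_induct)
    case self
    show ?case by (rule jump_0[OF assms(1)])
  next
    case (step y z)
    have "{y, z} \<notin> edges_at R"
      using step(3,4) by (auto simp: edges_at_def)
    then have "{y, z} \<notin> E"
      using nonconst_subset boundary_subset[OF assms(1)] by blast
    then show ?case
      using jump_const[OF assms(1), of y z] step(1,2) by (simp add: edge_rel_def)
  qed
qed

lemma swap_steps:
  assumes "E \<in> boundaries diff" "x \<in> simplicial_lattice"
  shows "fst (swap_heights E (f1, f2)) (x + gen i) - fst (swap_heights E (f1, f2)) x =
      (if {x, x + gen i} \<in> E then f2 (x + gen i) - f2 x else f1 (x + gen i) - f1 x)"
    "snd (swap_heights E (f1, f2)) (x + gen i) - snd (swap_heights E (f1, f2)) x =
      (if {x, x + gen i} \<in> E then f1 (x + gen i) - f1 x else f2 (x + gen i) - f2 x)"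
  using card_mult_jump_step[OF assms, of i] by (simp_all add: swap_heights_def)

lemma swap_in:
  assumes E: "E \<in> boundaries diff"
  shows "fst (swap_heights E (f1, f2)) \<in> height_functions_on R b"
    "snd (swap_heights E (f1, f2)) \<in> height_functions_on R b"
proof -
  let ?h1 = "fst (swap_heights E (f1, f2))" and ?h2 = "snd (swap_heights E (f1, f2))"
  have off: "?h1 u = f1 u" "?h2 u = f2 u" if "u \<notin> simplicial_lattice \<or> u \<in> simplicial_lattice - R" for u
  proof -
    have "jump E u = 0"
      using that jump_off_region[OF E, of u] potential_off[of u] by (auto simp: jump_def)
    then show "?h1 u = f1 u" "?h2 u = f2 u"
      by (simp_all add: swap_heights_def)
  qed
  have ext: "?h1 \<in> simplicial_lattice \<rightarrow>\<^sub>E UNIV" "?h2 \<in> simplicial_lattice \<rightarrow>\<^sub>E UNIV"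
    using heights off by (auto simp: height_functions_def PiE_def extensional_def)
  have h0: "?h1 0 = f1 0" "?h2 0 = f2 0"
    using off[of 0] R(2) by auto
  have "?h1 (x + gen i) - ?h1 x \<in> {1, 1 - int CARD('n)}" "?h2 (x + gen i) - ?h2 x \<in> {1, 1 - int CARD('n)}"
    if "x \<in> simplicial_lattice" for x i
    unfolding swap_steps[OF E that]
    using height_function_step[OF heights(1) that, of i] height_function_step[OF heights(2) that, of i]
    by auto
  then have "?h1 \<in> height_functions" "?h2 \<in> height_functions"
    using ext h0 heights by (auto simp: height_functions_def)
  then show "?h1 \<in> height_functions_on R b" "?h2 \<in> height_functions_on R b"
    using off f1 f2 by (auto simp: height_functions_on_def)
qed

text \<open>At each edge the exchange either swaps the two factors or leaves them alone.\<close>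

lemma swap_weight:
  assumes E: "E \<in> boundaries diff"
  shows "boltzmann_weight R w (fst (swap_heights E (f1, f2))) * boltzmann_weight R w (snd (swap_heights E (f1, f2))) =
    boltzmann_weight R w f1 * boltzmann_weight R w f2"
proof -
  have fin: "finite R" using R by (simp add: region_def)
  show ?thesis
    unfolding boltzmann_weight_eq[OF fin] prod.distrib[symmetric]
  proof (rule prod.cong[OF refl])
    fix e assume "e \<in> edges_at R"
    then have "e \<in> lattice_edges" by (simp add: edges_at_def)
    then obtain x i where x: "x \<in> simplicial_lattice" "e = {x, x + gen i}"
      by (rule lattice_edgeE)
    show "(if e \<in> down_edges (fst (swap_heights E (f1, f2))) then w e else 1) *
        (if e \<in> down_edges (snd (swap_heights E (f1, f2))) then w e else 1) =
        (if e \<in> down_edges f1 then w e else 1) * (if e \<in> down_edges f2 then w e else 1)"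
      unfolding x(2) down_edges_iff[OF card3 x(1)] swap_steps[OF E x(1)] by simp
  qed
qed

lemma swap_diff:
  "(\<lambda>u. fst (swap_heights E (f1, f2)) u - snd (swap_heights E (f1, f2)) u) = reflect E"
  by (rule ext) (simp add: swap_heights_def reflect_def)

lemma height_difference_swap:
  assumes "E \<in> boundaries diff" shows "height_difference (reflect E)"
  using height_difference_heights[OF card3, of "fst (swap_heights E (f1, f2))" "snd (swap_heights E (f1, f2))"]
    swap_in[OF assms] swap_diff[of E] by (simp add: height_functions_on_def)

text \<open>The exchange negates \<open>jump E\<close>, so repeating it adds back what was
  subtracted.\<close>

lemma swap_swap:
  assumes "E \<in> boundaries diff"
  shows "swap_heights E (swap_heights E (f1, f2)) = (f1, f2)"
proof -
  obtain h1 h2 where h: "swap_heights E (f1, f2) = (h1, h2)" by fastforce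
  have "(\<lambda>u. h1 u - h2 u) = reflect E"
    using swap_diff[of E] h by simp
  then have "height_jump h1 h2 E u = - jump E u" for u
    using jump_reflect[OF height_difference_swap[OF assms] assms assms] by simp
  then have "swap_heights E (h1, h2) = (\<lambda>u. h1 u + int CARD('n) * jump E u, \<lambda>u. h2 u - int CARD('n) * jump E u)"
    by (simp add: swap_heights_def)
  moreover have "h1 = (\<lambda>u. f1 u - int CARD('n) * jump E u)" "h2 = (\<lambda>u. f2 u + int CARD('n) * jump E u)"
    using h by (auto simp: swap_heights_def)
  ultimately show ?thesis
    by (simp add: h)
qed

lemma diff_product:
  assumes x: "x \<in> simplicial_lattice" and y: "y \<in> simplicial_lattice"
  shows "real_of_int (diff x) * real_of_int (diff y) = (real CARD('n))\<^sup>2 *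
    (real (card {E \<in> boundaries diff. separates_from_0 E x \<and> separates_from_0 E y}) +
     (\<Sum>(E, E')\<in>{(E, E'). E \<in> boundaries diff \<and> E' \<in> boundaries diff \<and> E \<noteq> E'}.
        real_of_int (jump E x) * real_of_int (jump E' y)))"
proof -
  let ?B = "boundaries diff"
  have fin: "finite ?B"
    by (rule finite_boundaries[OF finite_nonconst])
  have "diff u = int CARD('n) * (\<Sum>E\<in>?B. jump E u)" if "u \<in> simplicial_lattice" for u
    using g_eq_sum_jump[OF finite_nonconst _ that] eq_0 by simp
  then have "diff x * diff y = (int CARD('n))\<^sup>2 * ((\<Sum>E\<in>?B. jump E x) * (\<Sum>E\<in>?B. jump E y))"
    using x y by (simp add: power2_eq_square)
  also have "(\<Sum>E\<in>?B. jump E x) * (\<Sum>E\<in>?B. jump E y) = (\<Sum>(E, E')\<in>?B \<times> ?B. jump E x * jump E' y)"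
    by (simp add: sum_product sum.cartesian_product)
  also have "?B \<times> ?B = (\<lambda>E. (E, E)) ` ?B \<union> {(E, E'). E \<in> ?B \<and> E' \<in> ?B \<and> E \<noteq> E'}" (is "_ = ?D \<union> ?O")
    by auto
  also have "(\<Sum>(E, E')\<in>?D \<union> ?O. jump E x * jump E' y) =
      (\<Sum>(E, E')\<in>?D. jump E x * jump E' y) + (\<Sum>(E, E')\<in>?O. jump E x * jump E' y)"
  proof (rule sum.union_disjoint)
    show "finite ?O"
      by (rule finite_subset[of _ "?B \<times> ?B"]) (use fin in auto)
  qed (use fin in auto)
  also have "(\<Sum>(E, E')\<in>?D. jump E x * jump E' y) = (\<Sum>E\<in>?B. jump E x * jump E y)"
    by (subst sum.reindex) (auto simp: inj_on_def)
  also have "\<dots> = (\<Sum>E\<in>?B. if separates_from_0 E x \<and> separates_from_0 E y then 1 else 0)"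
  proof (rule sum.cong[OF refl])
    fix E assume E: "E \<in> ?B"
    \<comment> \<open>The same sign serves both points, so a nonzero product equals 1.\<close>
    obtain \<sigma> where "\<sigma> \<in> {1, -1}" "\<forall>u. jump E u \<in> {0, \<sigma>}"
      using jump_range[OF E] by blast
    then have "jump E x \<in> {0, \<sigma>}" "jump E y \<in> {0, \<sigma>}" "\<sigma> = 1 \<or> \<sigma> = -1"
      by blast+
    then show "jump E x * jump E y = (if separates_from_0 E x \<and> separates_from_0 E y then 1 else 0)"
      unfolding separates_iff[OF E x] separates_iff[OF E y] by auto
  qed
  also have "\<dots> = int (card {E \<in> ?B. separates_from_0 E x \<and> separates_from_0 E y})"
    by (simp add: sum.inter_filter[OF fin, symmetric])
  finally have "real_of_int (diff x * diff y) = real_of_int ((int CARD('n))\<^sup>2 *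
      (int (card {E \<in> ?B. separates_from_0 E x \<and> separates_from_0 E y}) + (\<Sum>(E, E')\<in>?O. jump E x * jump E' y)))"
    by (simp only:)
  then show ?thesis
    by (simp add: split_def)
qed

end

text \<open>The exchange along the first boundary \<open>E\<close> is an involution on triples
  \<open>(p, E, E')\<close>. It preserves the weight of the pair, negates \<open>jump E\<close> and,
  as \<open>E'\<close> differs from \<open>E\<close>, keeps \<open>jump E'\<close>; the whole sum is
  therefore its own negative.\<close>

lemma off_diagonal_cancels:
  fixes R :: "(real ^ 'n) set"
  assumes "CARD('n) \<ge> 3" "region R" "0 \<notin> R"
  shows "(\<Sum>(f1, f2)\<in>height_functions_on R b \<times> height_functions_on R b.
     boltzmann_weight R w f1 * boltzmann_weight R w f2 *
     (\<Sum>(E, E')\<in>{(E, E'). E \<in> boundaries (\<lambda>u. f1 u - f2 u) \<and> E' \<in> boundaries (\<lambda>u. f1 u - f2 u) \<and> E \<noteq> E'}.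
        real_of_int (height_jump f1 f2 E x) * real_of_int (height_jump f1 f2 E' y))) = 0"
proof -
  let ?S = "height_functions_on R b"
  let ?W = "boltzmann_weight R w"
  let ?B = "\<lambda>p. boundaries (\<lambda>u. fst p u - snd p u)"
  define offdiag where "offdiag p = {(E, E'). E \<in> ?B p \<and> E' \<in> ?B p \<and> E \<noteq> E'}" for p :: "(real ^ 'n \<Rightarrow> int) \<times> (real ^ 'n \<Rightarrow> int)"
  define t where "t = (\<lambda>(p, E, E'). ?W (fst p) * ?W (snd p) *
    (real_of_int (height_jump (fst p) (snd p) E x) * real_of_int (height_jump (fst p) (snd p) E' y)))"
  \<comment> \<open>The available boundaries depend on the pair \<open>p\<close>, so pairs and
    boundaries are summed jointly.\<close>
  define T where "T = (SIGMA p:?S \<times> ?S. offdiag p)"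
  define \<phi> where "\<phi> = (\<lambda>(p, E :: (real ^ 'n) set set, E' :: (real ^ 'n) set set). (swap_heights E p, E, E'))"
  have pair: "height_pair (fst p) (snd p) b R" if "p \<in> ?S \<times> ?S" for p
    by (rule height_pair.intro) (use that assms in auto)
  have fin_offdiag: "finite (offdiag p)" if "p \<in> ?S \<times> ?S" for p
  proof -
    interpret height_pair "fst p" "snd p" b R by (rule pair[OF that])
    have "finite (?B p \<times> ?B p)"
      by (intro finite_cartesian_product finite_boundaries[OF finite_nonconst])
    then show ?thesis
      by (rule finite_subset[rotated]) (auto simp: offdiag_def)
  qed
  have \<phi>: "\<phi> a \<in> T \<and> \<phi> (\<phi> a) = a \<and> t (\<phi> a) = - t a" if aT: "a \<in> T" for a
  proof -
    obtain p E E' where a: "a = (p, E, E')" "p \<in> ?S \<times> ?S" "E \<in> ?B p" "E' \<in> ?B p" "E \<noteq> E'"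
      using aT by (auto simp: T_def offdiag_def)
    interpret height_pair "fst p" "snd p" b R by (rule pair[OF a(2)])
    obtain h1 h2 where h: "swap_heights E p = (h1, h2)" by fastforce
    have diff: "(\<lambda>u. h1 u - h2 u) = reflect E"
      using swap_diff[of E] h by simp
    have "h1 \<in> ?S" "h2 \<in> ?S"
      using swap_in[OF a(3)] h by simp_all
    moreover have "boundaries (\<lambda>u. h1 u - h2 u) = ?B p"
      unfolding diff by (rule boundaries_reflect[OF a(3)])
    ultimately have "\<phi> a \<in> T"
      using a h by (simp add: T_def offdiag_def \<phi>_def)
    moreover have "\<phi> (\<phi> a) = a"
      using swap_swap[OF a(3)] a(1) by (simp add: \<phi>_def)
    moreover have "?W h1 * ?W h2 = ?W (fst p) * ?W (snd p)"
      using swap_weight[OF a(3), of w] h by simp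
    moreover have "height_jump h1 h2 E x = - jump E x" "height_jump h1 h2 E' y = jump E' y"
      unfolding diff using jump_reflect[OF height_difference_swap[OF a(3)] a(3)] a(3-5) by auto
    ultimately show ?thesis
      using a(1) h by (simp add: t_def \<phi>_def)
  qed
  have "sum t T = (\<Sum>a\<in>T. - t a)"
    by (rule sum.reindex_bij_witness[of T \<phi> \<phi>]) (use \<phi> in auto)
  then have "sum t T = 0"
    by (simp add: sum_negf)
  moreover have "sum t T = (\<Sum>p\<in>?S \<times> ?S. \<Sum>(E, E')\<in>offdiag p. t (p, E, E'))"
    unfolding T_def by (subst sum.Sigma)
      (use fin_offdiag finite_height_functions_on[OF _ assms(2), of b] assms(1) in \<open>auto simp: split_def\<close>)
  ultimately show ?thesis
    by (simp add: t_def offdiag_def split_def sum_distrib_left)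
qed

theorem theorem5p2:
  fixes d :: nat
    and R :: "(real ^ 'n) set"
    and b :: "real ^ 'n \<Rightarrow> int"
    and w :: "(real ^ 'n) set \<Rightarrow> real"
    and x y :: "real ^ 'n"
  assumes "d \<ge> 2" and "CARD('n) = d + 1"
    and "region R" and "0 \<notin> R"
    and "b \<in> height_functions"
    and "\<forall>e\<in>edges_at R. w e > 0"
    and "x \<in> simplicial_lattice" and "y \<in> simplicial_lattice"
  shows "covariance (pair_pmf (boltzmann R b w) (boltzmann R b w))
           (\<lambda>(f\<^sub>1, f\<^sub>2). real_of_int (f\<^sub>1 x)) (\<lambda>(f\<^sub>1, f\<^sub>2). real_of_int (f\<^sub>1 y)) =
         1/2 * (real d + 1)\<^sup>2 *
           measure_pmf.expectation (pair_pmf (boltzmann R b w) (boltzmann R b w))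
             (\<lambda>(f\<^sub>1, f\<^sub>2). let g = (\<lambda>u. f\<^sub>1 u - f\<^sub>2 u) in
                real (graph_dist (LSD g) (level_set g 0) (last_common_vertex g x y)))
       \<and> covariance (pair_pmf (boltzmann R b w) (boltzmann R b w))
           (\<lambda>(f\<^sub>1, f\<^sub>2). real_of_int (f\<^sub>1 x)) (\<lambda>(f\<^sub>1, f\<^sub>2). real_of_int (f\<^sub>1 y)) =
         1/2 * (real d + 1)\<^sup>2 *
           measure_pmf.expectation (pair_pmf (boltzmann R b w) (boltzmann R b w))
             (\<lambda>(f\<^sub>1, f\<^sub>2). let g = (\<lambda>u. f\<^sub>1 u - f\<^sub>2 u) in
                real (card {E \<in> boundaries g. separates_from_0 E x \<and> separates_from_0 E y}))"
proof -
  have card: "CARD('n) \<ge> 3" "CARD('n) \<ge> 2" "real CARD('n) = real d + 1"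
    using assms(1,2) by auto
  let ?p = "boltzmann R b w"
  let ?S = "height_functions_on R b"
  let ?W = "boltzmann_weight R w"
  define Z where "Z = (\<Sum>h\<in>?S. ?W h)"
  note fin = finite_height_functions_on[OF card(2) assms(3), of b]
  note pmf = pmf_boltzmann[OF card(2) assms(3,5,6), folded Z_def]
  have set: "set_pmf ?p \<subseteq> ?S"
    using pmf by (auto simp: set_pmf_eq)
  note expectation = measure_pmf_expectation_pair[OF fin set]
  have pair: "height_pair f1 f2 b R" if "f1 \<in> ?S" "f2 \<in> ?S" for f1 f2
    by (rule height_pair.intro) (use that assms card in auto)
  define N where "N f1 f2 = real (card {E \<in> boundaries (\<lambda>u. f1 u - f2 u). separates_from_0 E x \<and> separates_from_0 E y})"
    for f1 f2 :: "real ^ 'n \<Rightarrow> int"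
  define X where "X f1 f2 =
    (\<Sum>(E, E')\<in>{(E, E'). E \<in> boundaries (\<lambda>u. f1 u - f2 u) \<and> E' \<in> boundaries (\<lambda>u. f1 u - f2 u) \<and> E \<noteq> E'}.
        real_of_int (height_jump f1 f2 E x) * real_of_int (height_jump f1 f2 E' y))"
    for f1 f2 :: "real ^ 'n \<Rightarrow> int"
  have "(\<Sum>f1\<in>?S. \<Sum>f2\<in>?S. ?W f1 * ?W f2 * X f1 f2) = 0"
    using off_diagonal_cancels[OF card(1) assms(3,4), where b = b and w = w and x = x and y = y]
    by (simp add: sum.cartesian_product X_def)
  \<comment> \<open>One factor \<open>Z\<close> for each copy turns the weights into
    probabilities.\<close>
  then have "(\<Sum>f1\<in>?S. \<Sum>f2\<in>?S. (?W f1 * ?W f2 * X f1 f2) / Z\<^sup>2) = 0"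
    by (simp add: sum_divide_distrib[symmetric])
  then have X0: "(\<Sum>f1\<in>?S. \<Sum>f2\<in>?S. X f1 f2 * (pmf ?p f1 * pmf ?p f2)) = 0"
    by (simp add: pmf power2_eq_square mult_ac)
  \<comment> \<open>The integrand splits into the count \<open>N\<close> of boundaries separating
    both points from 0 and the off-diagonal part \<open>X\<close>, whose expectation vanishes by
    \<open>X0\<close>.\<close>
  have "measure_pmf.expectation (pair_pmf ?p ?p)
        (\<lambda>(f1, f2). (real_of_int (f1 x) - real_of_int (f2 x)) * (real_of_int (f1 y) - real_of_int (f2 y))) =
      (\<Sum>f1\<in>?S. \<Sum>f2\<in>?S. (real CARD('n))\<^sup>2 * (N f1 f2 * (pmf ?p f1 * pmf ?p f2)) +
        (real CARD('n))\<^sup>2 * (X f1 f2 * (pmf ?p f1 * pmf ?p f2)))"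
    unfolding expectation
  proof (intro sum.cong refl)
    fix f1 f2 assume f: "f1 \<in> ?S" "f2 \<in> ?S"
    have "(real_of_int (f1 x) - real_of_int (f2 x)) * (real_of_int (f1 y) - real_of_int (f2 y)) =
        (real CARD('n))\<^sup>2 * (N f1 f2 + X f1 f2)"
      using height_pair.diff_product[OF pair[OF f] assms(7,8)] by (simp add: N_def X_def)
    then show "(case (f1, f2) of (f1, f2) \<Rightarrow>
          (real_of_int (f1 x) - real_of_int (f2 x)) * (real_of_int (f1 y) - real_of_int (f2 y))) *
        (pmf ?p f1 * pmf ?p f2) =
        (real CARD('n))\<^sup>2 * (N f1 f2 * (pmf ?p f1 * pmf ?p f2)) +
        (real CARD('n))\<^sup>2 * (X f1 f2 * (pmf ?p f1 * pmf ?p f2))"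
      by (simp add: algebra_simps)
  qed
  also have "\<dots> = (real d + 1)\<^sup>2 * measure_pmf.expectation (pair_pmf ?p ?p) (\<lambda>(f1, f2). N f1 f2)"
    unfolding expectation using X0 card(3) by (simp add: sum.distrib sum_distrib_left[symmetric])
  finally have cov: "covariance (pair_pmf ?p ?p) (\<lambda>(f1, f2). real_of_int (f1 x)) (\<lambda>(f1, f2). real_of_int (f1 y)) =
      1/2 * (real d + 1)\<^sup>2 * measure_pmf.expectation (pair_pmf ?p ?p) (\<lambda>(f1, f2). N f1 f2)"
    by (simp add: covariance_pair_pmf[OF fin set])
  moreover have "measure_pmf.expectation (pair_pmf ?p ?p)
      (\<lambda>(f\<^sub>1, f\<^sub>2). let g = (\<lambda>u. f\<^sub>1 u - f\<^sub>2 u) in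
        real (graph_dist (LSD g) (level_set g 0) (last_common_vertex g x y))) =
      measure_pmf.expectation (pair_pmf ?p ?p) (\<lambda>(f1, f2). N f1 f2)"
    unfolding expectation
  proof (intro sum.cong refl)
    fix f1 f2 assume f: "f1 \<in> ?S" "f2 \<in> ?S"
    interpret height_pair f1 f2 b R by (rule pair[OF f])
    show "(case (f1, f2) of (f\<^sub>1, f\<^sub>2) \<Rightarrow> let g = (\<lambda>u. f\<^sub>1 u - f\<^sub>2 u) in
          real (graph_dist (LSD g) (level_set g 0) (last_common_vertex g x y))) * (pmf ?p f1 * pmf ?p f2) =
        (case (f1, f2) of (f1, f2) \<Rightarrow> N f1 f2) * (pmf ?p f1 * pmf ?p f2)"
      using graph_dist_last_common_vertex[OF assms(7,8)] by (simp add: N_def)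
  qed
  ultimately show ?thesis
    by (simp add: N_def Let_def)
qed

end
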